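(* Let $k \geq 2$, and let $\mathbf{c}_1 = (c_{1,1}, \dots, c_{1,n_1}), \dots, \mathbf{c}_k = (c_{k,1}, \dots, c_{k,n_k})$ be IP sequences. Let $r_1 \in [n_1], \dots, r_k \in [n_k]$, $t \in [\min\{r_1, \dots, r_k\}]$, and let $u$ be a non-negative real number such that $u > \frac{6-t}{3}$. If $c_{1,1} \geq t+u+1, \dots, c_{k,1} \geq t+u+1$, $\mathcal{A}_1 \subseteq \mathcal{S}_{\mathbf{c}_1,r_1}, \dots, \mathcal{A}_k \subseteq \mathcal{S}_{\mathbf{c}_k,r_k}$, and $\mathcal{A}_1, \dots, \mathcal{A}_k$ are cross-$t$-intersecting, then \[\prod_{i=1}^k |\mathcal{A}_i| \leq \prod_{i=1}^k \Bigg( \sum_{I \in \binom{[t+1,n_i]}{r_i-t}} \prod_{j \in I} c_{i,j} \Bigg).\] Moreover, if $u > 0$, then the bound is attained if and only if for some $T \in \bigcap_{i=1}^k \mathcal{S}_{\mathbf{c}_i,t}$ with $|\mathcal{S}_{\mathbf{c}_i,r_i}(T)| = |\mathcal{S}_{\mathbf{c}_i,r_i,t}|$ for each $i \in [k]$, $\mathcal{A}_i = \mathcal{S}_{\mathbf{c}_i,r_i}(T)$ for each $i \in [k]$.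
   Context: For integers $a,b$, $[a,b]$ is the set of positive integers $i$ with $a \leq i \leq b$, and $[n]=[1,n]$. $\binom{X}{q}$ is the family of all $q$-element subsets of $X$ (an empty product equals $1$). An IP sequence is a finite sequence $(c_1,\dots,c_n)$ of positive integers with $c_1 \leq \dots \leq c_n$. For an IP sequence $\mathbf{c}=(c_1,\dots,c_n)$ and $r \in [n]$, $\mathcal{S}_{\mathbf{c},r}$ is the family of all sets $\{(x_1,y_{x_1}),\dots,(x_r,y_{x_r})\}$ of pairs such that $\{x_1,\dots,x_r\} \in \binom{[n]}{r}$ (so $x_1,\dots,x_r$ are distinct) and $y_{x_j} \in [c_{x_j}]$ for each $j \in [r]$. For a family $\mathcal{F}$ and a set $T$, $\mathcal{F}(T) = \{F \in \mathcal{F} : T \subseteq F\}$. For $t \in [r]$, $\mathcal{S}_{\mathbf{c},r,t} = \{A \in \mathcal{S}_{\mathbf{c},r} : (x,1) \in A \text{ for each } x \in [t]\}$. Families $\mathcal{A}_1,\dots,\mathcal{A}_k$ (not necessarily distinct or non-empty) are cross-$t$-intersecting if for all $i,j \in [k]$ with $i \neq j$, $|A \cap B| \geq t$ for every $A \in \mathcal{A}_i$ and every $B \in \mathcal{A}_j$. *)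

theory Defs
  imports Complex_Main "HOL-Library.Ramsey"
begin

text \<open>
  A finite sequence \<open>(c\<^sub>1, \<dots>, c\<^sub>n)\<close> is a list of length \<open>n\<close>, with entries numbered from 1.
  The family of \<open>q\<close>-element subsets of \<open>X\<close> is \<^term>\<open>nsets X q\<close>.
\<close>

definition entry :: "nat list \<Rightarrow> nat \<Rightarrow> nat" where
  "entry c j = c ! (j - 1)"

definition IP_seq :: "nat list \<Rightarrow> bool" where
  "IP_seq c \<longleftrightarrow> sorted c \<and> (\<forall>a \<in> set c. 0 < a)"

definition labelled_sets :: "nat list \<Rightarrow> nat \<Rightarrow> (nat \<times> nat) set set" where
  "labelled_sets c r =
    {(\<lambda>x. (x, y x)) ` X | X y. X \<in> nsets {1..length c} r \<and> (\<forall>x \<in> X. y x \<in> {1..entry c x})}"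

definition members_containing :: "'a set set \<Rightarrow> 'a set \<Rightarrow> 'a set set" where
  "members_containing F T = {A \<in> F. T \<subseteq> A}"

definition labelled_sets_fixing :: "nat list \<Rightarrow> nat \<Rightarrow> nat \<Rightarrow> (nat \<times> nat) set set" where
  "labelled_sets_fixing c r t = {A \<in> labelled_sets c r. \<forall>x \<in> {1..t}. (x, 1) \<in> A}"

text \<open>
  All families considered below consist of finite sets; for infinite sets \<^const>\<open>card\<close> would be
  the wrong notion of size here.
\<close>

definition cross_intersecting :: "nat \<Rightarrow> nat \<Rightarrow> (nat \<Rightarrow> 'a set set) \<Rightarrow> bool" where
  "cross_intersecting t k \<A> \<longleftrightarrow>
    (\<forall>i \<in> {1..k}. \<forall>j \<in> {1..k}. i \<noteq> j \<longrightarrow> (\<forall>A \<in> \<A> i. \<forall>B \<in> \<A> j. t \<le> card (A \<inter> B)))"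

end

theory Submission
  imports Defs
begin

text \<open>
  It suffices to treat two families. If $a_i$ is the size of the $i$-th family divided by its claimed
  bound, then the theorem for pairs says $a_i a_j \leq 1$ for $i \neq j$, hence every factor except
  perhaps the largest one is at most 1, and the product is at most the product of the largest factor
  with any other one.

  For two families, replacing a label \<open>y > 1\<close> at a position \<open>x\<close> by the label 1, wherever this leads
  out of the family, keeps sizes and the cross-intersection property. Once no such replacement changes
  the families, any two members agree on \<open>t\<close> positions at which both carry the label 1
  (\<open>cross_ones\<close>). Counting the labelled sets with a given set \<open>X\<close> of positions labelled 1 gives a
  weight on sets of positions, and the problem becomes one about two weighted cross-\<open>t\<close>-intersecting
  families of subsets of \<open>{1..N}\<close>. The weight has two properties: exchanging the label 1 at a position
  for one of the other labels shows that deleting an element multiplies the weight by at least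
  $v = t + u$, and moving an element to a smaller position does not decrease the weight.

  The weighted problem (\<open>weighted_cross_intersection\<close>) is solved by studying a pair \<open>F, G\<close> of maximal
  weight product which is closed under moving elements to smaller positions. Suppose that any two
  members share \<open>t\<close> elements within \<open>{1..l}\<close>, and that this fails for \<open>l - 1\<close> because of \<open>A \<in> F\<close> and
  \<open>B \<in> G\<close>. Closedness forces \<open>A \<union> B\<close> to cover \<open>{1..l}\<close>, so that the traces of \<open>A\<close> and \<open>B\<close> on
  \<open>{1..l}\<close> have sizes \<open>i\<close> and \<open>j\<close> with $i + j = l + t$. One may then add to \<open>F\<close> all sets \<open>A - {l}\<close>,
  where \<open>A \<in> F\<close> has trace size \<open>i\<close>, at the price of those members of \<open>G\<close> that have trace size \<open>j\<close>
  and cannot spare \<open>l\<close>; or the other way round. The gained sets are heavier by the factor $v$, and a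
  double count bounds the lost ones by the fraction $j/l$ (or $i/l$). As neither exchange improves a
  maximal product, $v (l - i) \leq l$ and $v (l - j) \leq l$ (\<open>tight_bound\<close>). The hypothesis on $u$
  gives $2 v > t + 4$, which is incompatible with this once $l \geq t + 3$. So members of \<open>F\<close> and \<open>G\<close>
  share \<open>t\<close> elements within \<open>{1..t + 2}\<close>, and a short list of configurations on \<open>t + 2\<close> points remains
  to be compared with the families of all supersets of \<open>{1..t}\<close> (\<open>star_bound_closed\<close>).

  The extremal pairs are recovered from the closed ones. In the weighted problem an extremal closed
  pair contains the \<open>t\<close>-set \<open>{1..t}\<close> in both families. Moving elements preserves sizes of sets, so
  every extremal pair has a \<open>t\<close>-set in either family, and such sets determine the pair. For labelled
  sets of a fixed size \<open>r\<close> this shortcut is not available; instead each change of labels is undone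
  (\<open>slide_fixing_trace_back\<close>), which uses that a member can be relabelled so as to avoid two given sets
  outside \<open>T\<close>, there being at least three labels at every position.
\<close>

section \<open>Sliding\<close>

definition slide :: "'a \<Rightarrow> 'a \<Rightarrow> 'a set \<Rightarrow> 'a set" where
  "slide p q A = (if q \<in> A \<and> p \<notin> A then insert p (A - {q}) else A)"

text \<open>
  Sliding a whole family keeps those members whose slid set is already present. This makes the map
  injective on the family, so that no member is lost.
\<close>

definition slide_member :: "'a \<Rightarrow> 'a \<Rightarrow> 'a set set \<Rightarrow> 'a set \<Rightarrow> 'a set" where
  "slide_member p q F A = (if slide p q A \<in> F then A else slide p q A)"

definition slide_family :: "'a \<Rightarrow> 'a \<Rightarrow> 'a set set \<Rightarrow> 'a set set" where
  "slide_family p q F = slide_member p q F ` F"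

definition cross :: "nat \<Rightarrow> 'a set set \<Rightarrow> 'a set set \<Rightarrow> bool" where
  "cross t F G \<longleftrightarrow> (\<forall>A\<in>F. \<forall>B\<in>G. t \<le> card (A \<inter> B))"

lemma cross_commute: "cross t F G \<longleftrightarrow> cross t G F"
  unfolding cross_def by (metis Int_commute)

lemma card_slide: "finite A \<Longrightarrow> card (slide p q A) = card A"
  by (auto simp: slide_def card_Suc_Diff1 simp del: card_Diff_insert)

lemma inj_on_slide_member: "inj_on (slide_member p q F) F"
proof (rule inj_onI)
  fix A B assume AB: "A \<in> F" "B \<in> F" and eq: "slide_member p q F A = slide_member p q F B"
  have "A = B" if "slide p q A = slide p q B" "slide p q A \<notin> F"
  proof -
    have "q \<in> A \<and> p \<notin> A" "q \<in> B \<and> p \<notin> B"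
      using that AB by (auto simp: slide_def split: if_splits)
    then show ?thesis using that(1) by (auto simp: slide_def)
  qed
  then show "A = B" using AB eq by (auto simp: slide_member_def split: if_splits)
qed

lemma card_slide_family: "card (slide_family p q F) = card F"
  by (simp add: slide_family_def card_image inj_on_slide_member)

lemma slide_family_cases:
  assumes "A \<in> slide_family p q F"
  obtains "A \<in> F" "slide p q A \<in> F"
  | A0 where "A0 \<in> F" "q \<in> A0" "p \<notin> A0" "A = insert p (A0 - {q})"
  using assms by (auto simp: slide_family_def slide_member_def slide_def split: if_splits)

text \<open>
  If two members both stay or both move, their intersection keeps its size. If only \<open>B\<close> moves, an
  element is lost only when the other set \<open>A\<close> contains \<open>q\<close> but not \<open>p\<close>. Then \<open>A\<close> stayed because
  \<open>slide p q A\<close> is also present, and \<open>slide p q A\<close> meets the original \<open>B\<close> in exactly the elements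
  that \<open>A\<close> shares with the moved \<open>B\<close>.
\<close>

lemma cross_slide_family:
  assumes "cross t F G" "\<forall>A\<in>F. finite A" "\<forall>B\<in>G. finite B"
  shows "cross t (slide_family p q F) (slide_family p q G)"
proof -
  \<comment> \<open>a set that stays against a set that moves\<close>
  have mixed: "t \<le> card (A \<inter> insert p (B0 - {q}))"
    if c: "cross t F G" and A: "A \<in> F" "slide p q A \<in> F" and B: "B0 \<in> G" "q \<in> B0" "p \<notin> B0"
      and f: "finite A"
    for F G and A B0 :: "'a set"
  proof (cases "p \<in> A \<or> q \<notin> A")
    case True
    have "card (A \<inter> B0) \<le> card (A \<inter> insert p (B0 - {q}))"
    proof (cases "p \<in> A")
      case True
      have "card (A \<inter> B0) \<le> card (insert p (A \<inter> B0 - {q}))"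
        using f B by (auto simp: card_insert_if card_Diff_singleton_if)
      also have "insert p (A \<inter> B0 - {q}) = A \<inter> insert p (B0 - {q})" using True by auto
      finally show ?thesis .
    next
      case False
      then show ?thesis using \<open>p \<in> A \<or> q \<notin> A\<close> f by (intro card_mono) auto
    qed
    then show ?thesis using c A(1) B(1) by (force simp: cross_def)
  next
    case False
    then have "A \<inter> insert p (B0 - {q}) = slide p q A \<inter> B0"
      using B by (auto simp: slide_def)
    then show ?thesis using c A(2) B(1) by (auto simp: cross_def)
  qed
  show ?thesis
    unfolding cross_def
  proof (intro ballI)
    fix A B assume "A \<in> slide_family p q F" "B \<in> slide_family p q G"
    then show "t \<le> card (A \<inter> B)"
    proof (cases rule: slide_family_cases[case_product slide_family_cases])
      case "1_1"
      then show ?thesis using assms(1) by (auto simp: cross_def)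
    next
      case ("1_2" B0)
      then show ?thesis using mixed[OF assms(1), of A B0] assms(2) by auto
    next
      case ("2_1" A0)
      then show ?thesis
        using mixed[of G F B A0] assms(1,3) by (auto simp: cross_commute Int_commute)
    next
      case ("2_2" A0 B0)
      then have "A \<inter> B = insert p (A0 \<inter> B0 - {q})" by auto
      moreover have "card \<dots> = card (A0 \<inter> B0)"
        using "2_2" assms(2) card_gt_0_iff[of "A0 \<inter> B0"]
        by (auto simp: card_insert_if card_Diff_singleton_if)
      ultimately show ?thesis using "2_2" assms(1) by (auto simp: cross_def)
    qed
  qed
qed

lemma sum_slide_family:
  fixes g :: "'a set \<Rightarrow> real"
  assumes "\<And>A. A \<in> F \<Longrightarrow> q \<in> A \<Longrightarrow> p \<notin> A \<Longrightarrow> g A \<le> g (insert p (A - {q}))"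
  shows "sum g F \<le> sum g (slide_family p q F)"
proof -
  have "sum g F \<le> (\<Sum>A\<in>F. g (slide_member p q F A))"
    using assms by (intro sum_mono) (auto simp: slide_member_def slide_def)
  then show ?thesis by (simp add: slide_family_def sum.reindex inj_on_slide_member)
qed

definition potential :: "('a \<Rightarrow> nat) \<Rightarrow> 'a set set \<Rightarrow> nat" where
  "potential w F = (\<Sum>A\<in>F. sum w A)"

lemma sum_slide_less:
  fixes w :: "'a \<Rightarrow> nat"
  assumes "finite A" "w p < w q" "q \<in> A" "p \<notin> A"
  shows "sum w (slide p q A) < sum w A"
proof -
  have "sum w A = w q + sum w (A - {q})" using assms by (simp add: sum.remove)
  then show ?thesis using assms by (simp add: slide_def)
qed

lemma potential_slide_family:
  assumes "finite F" "\<forall>A\<in>F. finite A" "w p < w q"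
  shows "potential w (slide_family p q F) \<le> potential w F"
    and "A \<in> F \<Longrightarrow> slide p q A \<notin> F \<Longrightarrow> potential w (slide_family p q F) < potential w F"
proof -
  have le: "sum w (slide_member p q F A) \<le> sum w A" if "A \<in> F" for A
    using sum_slide_less[of A w p q] that assms by (auto simp: slide_member_def slide_def)
  have pot: "potential w (slide_family p q F) = (\<Sum>A\<in>F. sum w (slide_member p q F A))"
    by (simp add: potential_def slide_family_def sum.reindex inj_on_slide_member)
  show "potential w (slide_family p q F) \<le> potential w F"
    unfolding pot unfolding potential_def by (intro sum_mono le)
  show "potential w (slide_family p q F) < potential w F" if A: "A \<in> F" "slide p q A \<notin> F"
    unfolding pot unfolding potential_def
  proof (rule sum_strict_mono_ex1)
    show "\<exists>A\<in>F. sum w (slide_member p q F A) < sum w A"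
    proof
      have "q \<in> A \<and> p \<notin> A" using A by (auto simp: slide_def split: if_splits)
      then show "sum w (slide_member p q F A) < sum w A"
        using A sum_slide_less[of A w p q] assms by (simp add: slide_member_def)
    qed (fact A)
  qed (use assms le in auto)
qed


text \<open>
  Each slide that changes one of the families decreases the total weight of all elements of all
  members, so a property of closed pairs that can be pulled back along slides holds for all pairs.
\<close>

lemma slide_induct [consumes 1, case_names weight finite closed inv step]:
  fixes w :: "'a \<Rightarrow> nat"
  assumes "I F G"
    and weight: "\<And>p q. R p q \<Longrightarrow> w p < w q"
    and finite: "\<And>F G. I F G \<Longrightarrow> finite F \<and> finite G \<and> (\<forall>A\<in>F \<union> G. finite A)"
    and closed: "\<And>F G. I F G \<Longrightarrow> (\<And>p q A. R p q \<Longrightarrow> A \<in> F \<Longrightarrow> slide p q A \<in> F)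
      \<Longrightarrow> (\<And>p q B. R p q \<Longrightarrow> B \<in> G \<Longrightarrow> slide p q B \<in> G) \<Longrightarrow> P F G"
    and inv: "\<And>p q F G. R p q \<Longrightarrow> I F G \<Longrightarrow> I (slide_family p q F) (slide_family p q G)"
    and step: "\<And>p q F G. R p q \<Longrightarrow> I F G \<Longrightarrow> P (slide_family p q F) (slide_family p q G) \<Longrightarrow> P F G"
  shows "P F G"
  using \<open>I F G\<close>
proof (induction "potential w F + potential w G" arbitrary: F G rule: less_induct)
  case less
  note fin = finite[OF less.prems]
  show ?case
  proof (cases "\<exists>p q. R p q \<and> (\<exists>A. A \<in> F \<and> slide p q A \<notin> F \<or> A \<in> G \<and> slide p q A \<notin> G)")
    case True
    then obtain p q A where pq: "R p q" and A: "A \<in> F \<and> slide p q A \<notin> F \<or> A \<in> G \<and> slide p q A \<notin> G"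
      by blast
    have fin': "finite F" "finite G" "\<forall>A\<in>F. finite A" "\<forall>A\<in>G. finite A" using fin by auto
    note pF = potential_slide_family[OF fin'(1,3) weight[OF pq]]
    note pG = potential_slide_family[OF fin'(2,4) weight[OF pq]]
    have "potential w (slide_family p q F) + potential w (slide_family p q G)
        < potential w F + potential w G"
      using A pF pG by (meson add_le_less_mono add_less_le_mono)
    then show ?thesis
      using less.hyps inv[OF pq less.prems] step[OF pq less.prems] by blast
  next
    case False
    then show ?thesis using closed[OF less.prems] by blast
  qed
qed

section \<open>Sliding weights and essential members\<close>

definition sliding_weight :: "nat \<Rightarrow> real \<Rightarrow> (nat set \<Rightarrow> real) \<Rightarrow> bool" where
  "sliding_weight N v g \<longleftrightarrow>
    (\<forall>X. 0 \<le> g X) \<and>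
    (\<forall>X x. X \<subseteq> {1..N} \<longrightarrow> x \<in> X \<longrightarrow> v * g X \<le> g (X - {x})) \<and>
    (\<forall>X p q. X \<subseteq> {1..N} \<longrightarrow> 1 \<le> p \<longrightarrow> p < q \<longrightarrow> q \<in> X \<longrightarrow> p \<notin> X \<longrightarrow> g X \<le> g (insert p (X - {q})))"

lemma sliding_weightD:
  assumes "sliding_weight N v g"
  shows sliding_weight_nonneg: "0 \<le> g X"
    and sliding_weight_delete: "X \<subseteq> {1..N} \<Longrightarrow> x \<in> X \<Longrightarrow> v * g X \<le> g (X - {x})"
    and sliding_weight_slide: "X \<subseteq> {1..N} \<Longrightarrow> 1 \<le> p \<Longrightarrow> p < q \<Longrightarrow> q \<in> X \<Longrightarrow> p \<notin> X
      \<Longrightarrow> g X \<le> g (insert p (X - {q}))"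
  using assms unfolding sliding_weight_def by blast+

lemma weight_delete_family:
  assumes g: "sliding_weight N v g" and U: "U \<subseteq> Pow {1..N}" "\<forall>X\<in>U. x \<in> X"
    and W: "(\<lambda>X. X - {x}) ` U \<subseteq> W" "W \<subseteq> Pow {1..N}"
  shows "v * sum g U \<le> sum g W"
proof -
  have inj: "inj_on (\<lambda>X. X - {x}) U" using U(2) by (intro inj_onI) blast
  have "v * sum g U = (\<Sum>X\<in>U. v * g X)" by (simp add: sum_distrib_left)
  also have "\<dots> \<le> (\<Sum>X\<in>U. g (X - {x}))"
    using U by (intro sum_mono sliding_weight_delete[OF g]) auto
  also have "\<dots> = sum g ((\<lambda>X. X - {x}) ` U)" by (simp add: sum.reindex inj)
  also have "\<dots> \<le> sum g W"
    using W by (intro sum_mono2 sliding_weight_nonneg[OF g]) (auto intro: finite_subset)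
  finally show ?thesis .
qed

lemma weight_slide_family:
  assumes g: "sliding_weight N v g" and U: "U \<subseteq> Pow {1..N}" "\<forall>X\<in>U. q \<in> X \<and> p \<notin> X"
    and pq: "1 \<le> p" "p < q"
    and W: "(\<lambda>X. insert p (X - {q})) ` U \<subseteq> W" "W \<subseteq> Pow {1..N}"
  shows "sum g U \<le> sum g W"
proof -
  have inj: "inj_on (\<lambda>X. insert p (X - {q})) U"
  proof (rule inj_onI)
    fix X Y assume "X \<in> U" "Y \<in> U" "insert p (X - {q}) = insert p (Y - {q})"
    with U(2) have "X - {q} = Y - {q}" "q \<in> X" "q \<in> Y" by (metis DiffD1 insert_ident)+
    then show "X = Y" by (metis insert_Diff)
  qed
  have "sum g U \<le> (\<Sum>X\<in>U. g (insert p (X - {q})))"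
    using U pq by (intro sum_mono sliding_weight_slide[OF g]) auto
  also have "\<dots> = sum g ((\<lambda>X. insert p (X - {q})) ` U)" by (simp add: sum.reindex inj)
  also have "\<dots> \<le> sum g W"
    using W by (intro sum_mono2 sliding_weight_nonneg[OF g]) (auto intro: finite_subset)
  finally show ?thesis .
qed

lemma subfamily_bounds: "F \<subseteq> Pow {1..N} \<Longrightarrow> A \<in> F \<Longrightarrow> x \<in> A \<Longrightarrow> 1 \<le> x \<and> x \<le> N" for N :: nat
  by (meson PowD atLeastAtMost_iff subsetD)

definition slide_closed :: "nat \<Rightarrow> nat set set \<Rightarrow> bool" where
  "slide_closed N F \<longleftrightarrow> (\<forall>A\<in>F. \<forall>p q. 1 \<le> p \<longrightarrow> p < q \<longrightarrow> q \<le> N \<longrightarrow> slide p q A \<in> F)"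

lemma slide_closedD:
  assumes "slide_closed N F" "F \<subseteq> Pow {1..N}" "A \<in> F" "q \<in> A" "p \<notin> A" "1 \<le> p" "p < q"
  shows "insert p (A - {q}) \<in> F"
proof -
  have "q \<le> N" using subfamily_bounds[OF assms(2,3,4)] by simp
  then have "slide p q A \<in> F" using assms unfolding slide_closed_def by blast
  then show ?thesis using assms by (simp add: slide_def)
qed

text \<open>
  The intersection property localised to an initial segment. The proof lowers \<open>l\<close> step by step.
\<close>

definition agree :: "nat \<Rightarrow> nat \<Rightarrow> nat set set \<Rightarrow> nat set set \<Rightarrow> bool" where
  "agree t l F G \<longleftrightarrow> (\<forall>A\<in>F. \<forall>B\<in>G. t \<le> card (A \<inter> B \<inter> {1..l}))"

text \<open>
  Of these members one push adds copies without \<open>l\<close>, and the opposite push discards them. The trace size \<open>i\<close> is a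
  parameter because a push in one family involves only one trace size of the other.
\<close>

definition essential :: "nat \<Rightarrow> nat \<Rightarrow> nat set set \<Rightarrow> nat set set" where
  "essential l i F = {A \<in> F. l \<in> A \<and> card (A \<inter> {1..l}) = i \<and> A - {l} \<notin> F}"

lemma agree_commute: "agree t l F G \<longleftrightarrow> agree t l G F"
  unfolding agree_def by (metis Int_commute)

lemma agree_imp_cross:
  assumes "agree t l F G" "F \<subseteq> Pow {1..N}"
  shows "cross t F G"
  unfolding cross_def
proof (intro ballI)
  fix A B assume AB: "A \<in> F" "B \<in> G"
  then have "t \<le> card (A \<inter> B \<inter> {1..l})" using assms(1) by (auto simp: agree_def)
  also have "\<dots> \<le> card (A \<inter> B)"
    using AB(1) assms(2) by (intro card_mono) (auto intro: finite_subset)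
  finally show "t \<le> card (A \<inter> B)" .
qed

text \<open>
  If an element \<open>e < l\<close> were missing from both sets, moving \<open>l\<close> to \<open>e\<close> in \<open>A\<close> would lose a common
  element. Hence the traces cover \<open>{1..l}\<close>, and inclusion-exclusion gives the sum of their sizes. The
  same loss would occur if \<open>A - {l}\<close> were a member.
\<close>

lemma tight_essential:
  assumes "agree t l F G" "slide_closed N F" "F \<subseteq> Pow {1..N}"
    and AB: "A \<in> F" "B \<in> G" "l \<in> A" "l \<in> B" and tight: "card (A \<inter> B \<inter> {1..l}) = t"
  shows "A \<union> B \<supseteq> {1..l}"
    and "card (A \<inter> {1..l}) + card (B \<inter> {1..l}) = l + t"
    and "A \<in> essential l (card (A \<inter> {1..l})) F"
proof -
  have l: "1 \<le> l" using subfamily_bounds[OF assms(3) AB(1,3)] by simp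
  have less: "card (A' \<inter> B \<inter> {1..l}) < t" if "A' \<inter> B \<inter> {1..l} \<subseteq> A \<inter> B \<inter> {1..l} - {l}" for A'
  proof -
    have "card (A' \<inter> B \<inter> {1..l}) \<le> card (A \<inter> B \<inter> {1..l} - {l})"
      using that by (intro card_mono) auto
    also have "\<dots> < card (A \<inter> B \<inter> {1..l})" using AB l by (intro card_Diff1_less) auto
    finally show ?thesis using tight by simp
  qed
  show U: "A \<union> B \<supseteq> {1..l}"
  proof
    fix e assume e: "e \<in> {1..l}"
    show "e \<in> A \<union> B"
    proof (rule ccontr)
      assume ne: "e \<notin> A \<union> B"
      then have "e < l" using e AB by (cases "e = l") auto
      then have "insert e (A - {l}) \<in> F"
        using slide_closedD[OF assms(2,3) AB(1,3)] ne e by auto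
      moreover have "card (insert e (A - {l}) \<inter> B \<inter> {1..l}) < t" using ne by (intro less) auto
      ultimately show False using assms(1) AB(2) by (force simp: agree_def)
    qed
  qed
  have "card (A \<inter> {1..l}) + card (B \<inter> {1..l})
      = card ((A \<inter> {1..l}) \<union> (B \<inter> {1..l})) + card ((A \<inter> {1..l}) \<inter> (B \<inter> {1..l}))"
    by (intro card_Un_Int) auto
  also have "(A \<inter> {1..l}) \<union> (B \<inter> {1..l}) = {1..l}" using U by auto
  also have "(A \<inter> {1..l}) \<inter> (B \<inter> {1..l}) = A \<inter> B \<inter> {1..l}" by auto
  finally show "card (A \<inter> {1..l}) + card (B \<inter> {1..l}) = l + t" using tight by simp
  have "A - {l} \<notin> F"
    using less[of "A - {l}"] assms(1) AB(2) by (force simp: agree_def)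
  then show "A \<in> essential l (card (A \<inter> {1..l})) F" using AB by (simp add: essential_def)
qed

text \<open>
  Removing \<open>l\<close> from a set \<open>A\<close> of trace size \<open>i\<close> is harmful only for partners \<open>B\<close> that contain \<open>l\<close>
  and form a tight pair with \<open>A\<close>; these are essential with trace size $j = l + t - i$.
\<close>

lemma cross_push:
  assumes ag: "agree t l F G" and cl: "slide_closed N F" "slide_closed N G"
    and sub: "F \<subseteq> Pow {1..N}" "G \<subseteq> Pow {1..N}" and ij: "i + j = l + t"
  shows "cross t (F \<union> (\<lambda>A. A - {l}) ` essential l i F) (G - essential l j G)"
proof -
  have "t \<le> card ((A - {l}) \<inter> B)" if A: "A \<in> essential l i F" and B: "B \<in> G - essential l j G" for A B
  proof -
    have A': "A \<in> F" "l \<in> A" "card (A \<inter> {1..l}) = i" using A by (auto simp: essential_def)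
    then have l: "1 \<le> l" using subfamily_bounds[OF sub(1)] by blast
    have fin: "finite A" using A' sub by (auto intro: finite_subset)
    have t: "t \<le> card (A \<inter> B \<inter> {1..l})" using ag A' B by (auto simp: agree_def)
    have "t \<le> card (A \<inter> B \<inter> {1..l} - {l})"
    proof (cases "l \<in> B")
      case True
      have "card (A \<inter> B \<inter> {1..l}) \<noteq> t"
      proof
        assume tight: "card (A \<inter> B \<inter> {1..l}) = t"
        have tight': "card (B \<inter> A \<inter> {1..l}) = t" using tight by (simp add: Int_commute)
        have ag': "agree t l G F" using ag by (simp add: agree_commute)
        have "B \<in> essential l (card (B \<inter> {1..l})) G"
          using tight_essential(3)[OF ag' cl(2) sub(2) _ A'(1) True A'(2) tight'] B by auto
        moreover have "card (B \<inter> {1..l}) = j"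
          using tight_essential(2)[OF ag cl(1) sub(1) A'(1) _ A'(2) True tight] B A'(3) ij by auto
        ultimately show False using B by auto
      qed
      then show ?thesis using t True A'(2) l by (simp add: card_Diff_singleton)
    next
      case False
      then show ?thesis using t by simp
    qed
    also have "\<dots> \<le> card ((A - {l}) \<inter> B)" using fin by (intro card_mono) auto
    finally show ?thesis .
  qed
  moreover have "t \<le> card (A \<inter> B)" if "A \<in> F" "B \<in> G" for A B
    using agree_imp_cross[OF ag sub(1)] that by (auto simp: cross_def)
  ultimately show ?thesis unfolding cross_def by blast
qed

lemma weight_push:
  assumes g: "sliding_weight N v g" and sub: "F \<subseteq> Pow {1..N}"
  shows "sum g F + v * sum g (essential l i F) \<le> sum g (F \<union> (\<lambda>A. A - {l}) ` essential l i F)"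
proof -
  have fin: "finite F" using sub finite_subset by fastforce
  have "v * sum g (essential l i F) \<le> sum g ((\<lambda>A. A - {l}) ` essential l i F)"
    using sub by (intro weight_delete_family[OF g, where x = l]) (auto simp: essential_def)
  moreover have "sum g (F \<union> (\<lambda>A. A - {l}) ` essential l i F)
      = sum g F + sum g ((\<lambda>A. A - {l}) ` essential l i F)"
    using fin by (intro sum.union_disjoint) (auto simp: essential_def)
  ultimately show ?thesis by simp
qed

text \<open>
  Double counting of the pairs \<open>(A, e)\<close> with \<open>A\<close> essential and \<open>e \<in> {1..l} - A\<close>. Moving \<open>l\<close> to \<open>e\<close>
  gives a member of no smaller weight that does not contain \<open>l\<close> and still has trace size \<open>i\<close>. There
  are \<open>l - i\<close> choices of \<open>e\<close> for each \<open>A\<close>, while a given image has at most \<open>i\<close> elements \<open>e\<close> to come from.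
\<close>

lemma essential_le:
  assumes g: "sliding_weight N v g" and sub: "F \<subseteq> Pow {1..N}" and cl: "slide_closed N F"
  shows "real l * sum g (essential l i F) \<le> real i * sum g F"
proof (cases "essential l i F = {}")
  case True
  then show ?thesis using sliding_weight_nonneg[OF g] by (simp add: sum_nonneg)
next
  case False
  have fin: "finite F" using sub finite_subset by fastforce
  let ?E = "essential l i F" and ?R = "{A \<in> F. l \<notin> A \<and> card (A \<inter> {1..l}) = i}"
  have E: "A \<in> F" "l \<in> A" "card (A \<inter> {1..l}) = i" "A \<subseteq> {1..N}" if "A \<in> ?E" for A
    using that sub by (auto simp: essential_def)
  have l: "1 \<le> l" using False E by fastforce
  have fE: "finite ?E" "finite ?R" using fin by (auto simp: essential_def)
  define P where "P = (SIGMA A:?E. {1..l} - A)"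
  define Q where "Q = (SIGMA A:?R. A \<inter> {1..l})"
  define f where "f = (\<lambda>(A, e). (insert e (A - {l}), e))"
  have il: "i \<le> l"
  proof -
    obtain A where "A \<in> ?E" using False by auto
    then show ?thesis using E(3)[of A] card_mono[of "{1..l}" "A \<inter> {1..l}"] by simp
  qed
  have "real (l - i) * sum g ?E = (\<Sum>A\<in>?E. \<Sum>e\<in>{1..l} - A. g A)"
  proof -
    have "card ({1..l} - A) = l - i" if "A \<in> ?E" for A
      using E(3)[OF that] by (simp add: card_Diff_subset_Int Int_commute)
    then show ?thesis by (simp add: sum_distrib_left)
  qed
  also have "\<dots> = (\<Sum>(A, e)\<in>P. g A)" unfolding P_def using fE by (subst sum.Sigma) auto
  also have "\<dots> \<le> (\<Sum>z\<in>P. g (fst (f z)))"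
  proof (intro sum_mono)
    fix z assume "z \<in> P"
    then obtain A e where z: "z = (A, e)" "A \<in> ?E" "1 \<le> e" "e \<le> l" "e \<notin> A" by (auto simp: P_def)
    then have "e < l" using E(2)[of A] by (cases "e = l") auto
    then show "(case z of (A, e) \<Rightarrow> g A) \<le> g (fst (f z))"
      using sliding_weight_slide[OF g E(4)[OF z(2)] z(3) _ E(2)[OF z(2)] z(5)] z(1) by (simp add: f_def)
  qed
  also have "\<dots> = (\<Sum>z\<in>f ` P. g (fst z))"
  proof -
    have "inj_on f P"
    proof (rule inj_onI)
      fix y z assume yz: "y \<in> P" "z \<in> P" and eq: "f y = f z"
      obtain A e A' where A: "y = (A, e)" "z = (A', e)" using eq by (cases y; cases z) (auto simp: f_def)
      then have "l \<in> A" "l \<in> A'" "e \<notin> A" "e \<notin> A'" "insert e (A - {l}) = insert e (A' - {l})"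
        using yz eq E(2) by (auto simp: P_def f_def)
      then have "A - {l} = A' - {l}" by (metis DiffD1 insert_ident)
      then have "A = A'" using \<open>l \<in> A\<close> \<open>l \<in> A'\<close> by (metis insert_Diff)
      then show "y = z" using A by simp
    qed
    then show ?thesis by (simp add: sum.reindex)
  qed
  also have "\<dots> \<le> (\<Sum>z\<in>Q. g (fst z))"
  proof (intro sum_mono2 sliding_weight_nonneg[OF g])
    show "finite Q" unfolding Q_def using fE by auto
    show "f ` P \<subseteq> Q"
    proof
      fix y assume "y \<in> f ` P"
      then obtain A e where z: "y = (insert e (A - {l}), e)" "A \<in> ?E" "1 \<le> e" "e \<le> l" "e \<notin> A"
        by (auto simp: P_def f_def)
      have el: "e < l" using E(2)[of A] z by (cases "e = l") auto
      have "insert e (A - {l}) \<in> F"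
        using slide_closedD[OF cl sub E(1,2)[OF z(2)] z(5,3) el] .
      moreover have "card (insert e (A - {l}) \<inter> {1..l}) = i"
      proof -
        have "insert e (A - {l}) \<inter> {1..l} = insert e ((A \<inter> {1..l}) - {l})" using z el by auto
        moreover have "card \<dots> = card (A \<inter> {1..l})"
          using z E(2)[OF z(2)] l by (simp add: card_insert_if card_Suc_Diff1 del: card_Diff_insert)
        ultimately show ?thesis using E(3)[OF z(2)] by simp
      qed
      ultimately show "y \<in> Q" using z el by (auto simp: Q_def)
    qed
  qed
  also have "\<dots> = (\<Sum>A\<in>?R. \<Sum>e\<in>A \<inter> {1..l}. g A)"
    unfolding Q_def using fE by (subst sum.Sigma) (auto simp: case_prod_beta)
  also have "\<dots> = real i * sum g ?R" by (simp add: sum_distrib_left)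
  finally have "real (l - i) * sum g ?E \<le> real i * sum g ?R" .
  moreover have "sum g ?E + sum g ?R \<le> sum g F"
  proof -
    have "sum g ?E + sum g ?R = sum g (?E \<union> ?R)"
      using fE by (intro sum.union_disjoint[symmetric]) (auto simp: essential_def)
    also have "\<dots> \<le> sum g F"
      using fin by (intro sum_mono2 sliding_weight_nonneg[OF g]) (auto simp: essential_def)
    finally show ?thesis .
  qed
  then have "real i * (sum g ?E + sum g ?R) \<le> real i * sum g F" by (intro mult_left_mono) auto
  ultimately show ?thesis using il by (simp add: of_nat_diff algebra_simps)
qed

text \<open>
  Here \<open>a\<close> and \<open>b\<close> are the weights of the essential parts of two families of weights \<open>\<alpha>\<close> and \<open>\<beta>\<close>.
  Each of the two pushes fails to increase \<open>\<alpha> * \<beta>\<close>. Combining the first failure with the bound on \<open>b\<close>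
  shows that \<open>a\<close> is at most the fraction $j / (v (l - j))$ of \<open>\<alpha>\<close>, which is much sharper than $i / l$
  when \<open>i\<close> is close to \<open>l\<close>; this is then used in the second failure.
\<close>

lemma push_arithmetic:
  fixes \<alpha> \<beta> a b v :: real and i j l t :: nat
  assumes pos: "0 < a" "0 < b" "0 < \<alpha>" "0 < \<beta>" and v: "0 < v" and l: "0 < l"
    and a: "real l * a \<le> real i * \<alpha>" and b: "real l * b \<le> real j * \<beta>"
    and push_g: "(\<alpha> + v * a) * (\<beta> - b) \<le> \<alpha> * \<beta>"
    and push_h: "(\<alpha> - a) * (\<beta> + v * b) \<le> \<alpha> * \<beta>"
  shows "v * (real l - real j) \<le> real l"
proof (cases "j \<le> l")
  case False
  then show ?thesis using v by (smt (verit) mult_nonneg_nonpos of_nat_0_le_iff of_nat_mono not_le_imp_less less_imp_le)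
next
  case True
  define m where "m = real l - real j"
  have m: "0 \<le> m" using True by (simp add: m_def)
  have 1: "v * a * (\<beta> - b) \<le> \<alpha> * b" using push_g by (simp add: algebra_simps)
  have 2: "v * b * (\<alpha> - a) \<le> a * \<beta>" using push_h by (simp add: algebra_simps)
  have 3: "m * \<beta> \<le> real l * (\<beta> - b)" using b by (simp add: m_def algebra_simps)
  have 4: "v * a * m * \<beta> \<le> real l * \<alpha> * b"
  proof -
    have "v * a * (m * \<beta>) \<le> v * a * (real l * (\<beta> - b))"
      using 3 pos v by (intro mult_left_mono) auto
    also have "\<dots> \<le> real l * (\<alpha> * b)" using mult_left_mono[OF 1, of "real l"] by (simp add: algebra_simps)
    finally show ?thesis by (simp add: algebra_simps)
  qed
  \<comment> \<open>the improved upper bound for the essential part of the first family\<close>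
  have 5: "v * a * m \<le> real j * \<alpha>"
  proof -
    have "v * a * m * \<beta> \<le> \<alpha> * (real l * b)" using 4 by (simp add: algebra_simps)
    also have "\<dots> \<le> \<alpha> * (real j * \<beta>)" using b pos by (intro mult_left_mono) auto
    finally have "(v * a * m) * \<beta> \<le> (real j * \<alpha>) * \<beta>" by (simp add: algebra_simps)
    then show ?thesis using pos by simp
  qed
  have 6: "v * v * m * (\<alpha> - a) \<le> real l * \<alpha>"
  proof -
    have "v * m * (v * b * (\<alpha> - a)) \<le> v * m * (a * \<beta>)" using 2 v m by (intro mult_left_mono) auto
    also have "\<dots> \<le> real l * \<alpha> * b" using 4 by (simp add: algebra_simps)
    finally have "(v * v * m * (\<alpha> - a)) * b \<le> (real l * \<alpha>) * b" by (simp add: algebra_simps)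
    then show ?thesis using pos by simp
  qed
  have "v * v * m * \<alpha> \<le> real l * \<alpha> + v * (v * a * m)" using 6 by (simp add: algebra_simps)
  also have "\<dots> \<le> real l * \<alpha> + v * (real j * \<alpha>)" using 5 v by (intro add_left_mono mult_left_mono) auto
  finally have "(v * v * m) * \<alpha> \<le> (real l + v * real j) * \<alpha>" by (simp add: algebra_simps)
  then have "v * v * m \<le> real l + v * real j" using pos by simp
  then have "(v * m) * (v + 1) \<le> real l * (v + 1)" by (simp add: m_def algebra_simps)
  then show ?thesis using v by (simp add: m_def)
qed

section \<open>Maximal pairs agree on short initial segments\<close>

definition star :: "nat \<Rightarrow> nat set \<Rightarrow> nat set set" where
  "star N T = {X. X \<subseteq> {1..N} \<and> T \<subseteq> X}"

definition maximal_pair :: "nat \<Rightarrow> nat \<Rightarrow> (nat set \<Rightarrow> real) \<Rightarrow> (nat set \<Rightarrow> real) \<Rightarrow> nat set set \<Rightarrow> nat set set \<Rightarrow> bool" where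
  "maximal_pair N t g h F G \<longleftrightarrow> F \<subseteq> Pow {1..N} \<and> G \<subseteq> Pow {1..N} \<and> cross t F G \<and>
     (\<forall>F' G'. F' \<subseteq> Pow {1..N} \<longrightarrow> G' \<subseteq> Pow {1..N} \<longrightarrow> cross t F' G' \<longrightarrow> sum g F' * sum h G' \<le> sum g F * sum h G)"

lemma maximal_pairD:
  assumes "maximal_pair N t g h F G"
  shows "F \<subseteq> Pow {1..N}" "G \<subseteq> Pow {1..N}" "cross t F G"
    "F' \<subseteq> Pow {1..N} \<Longrightarrow> G' \<subseteq> Pow {1..N} \<Longrightarrow> cross t F' G' \<Longrightarrow> sum g F' * sum h G' \<le> sum g F * sum h G"
  using assms by (auto simp: maximal_pair_def)

lemma maximal_pair_commute: "maximal_pair N t g h F G \<longleftrightarrow> maximal_pair N t h g G F"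
  unfolding maximal_pair_def by (metis (no_types, opaque_lifting) cross_commute mult.commute)

lemma sum_family_pos:
  assumes "sliding_weight N v g" "F \<subseteq> Pow {1..N}" "A \<in> F" "0 < g A"
  shows "0 < sum g F"
  using assms by (intro sum_pos2) (auto intro: finite_subset sliding_weight_nonneg)

text \<open>
  The two pushes, of \<open>F\<close> at the expense of \<open>G\<close> and the reverse, do not increase the product of a
  maximal pair, and both essential parts have positive weight because they contain \<open>A\<close> and \<open>B\<close>.
\<close>

lemma tight_bound_right:
  assumes g: "sliding_weight N v g" and h: "sliding_weight N v h" and v: "0 < v"
    and mx: "maximal_pair N t g h F G"
    and pos: "\<forall>A\<in>F. 0 < g A" "\<forall>B\<in>G. 0 < h B"
    and cl: "slide_closed N F" "slide_closed N G" and ag: "agree t l F G"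
    and AB: "A \<in> F" "B \<in> G" "l \<in> A" "l \<in> B" and tight: "card (A \<inter> B \<inter> {1..l}) = t"
  shows "v * (real l - real (card (B \<inter> {1..l}))) \<le> real l"
proof -
  note D = maximal_pairD[OF mx]
  define i j where "i = card (A \<inter> {1..l})" and "j = card (B \<inter> {1..l})"
  let ?a = "sum g (essential l i F)" and ?b = "sum h (essential l j G)"
  have ag': "agree t l G F" using ag by (simp add: agree_commute)
  have tight': "card (B \<inter> A \<inter> {1..l}) = t" using tight by (simp add: Int_commute)
  have ij: "i + j = l + t" unfolding i_def j_def
    by (rule tight_essential(2)[OF ag cl(1) D(1) AB tight])
  have eA: "A \<in> essential l i F" unfolding i_def
    by (rule tight_essential(3)[OF ag cl(1) D(1) AB tight])
  have eB: "B \<in> essential l j G" unfolding j_def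
    by (rule tight_essential(3)[OF ag' cl(2) D(2) AB(2,1,4,3) tight'])
  have sE: "essential l i F \<subseteq> Pow {1..N}" "essential l j G \<subseteq> Pow {1..N}"
    using D(1,2) by (auto simp: essential_def)
  have fin: "finite F" "finite G" using D(1,2) by (auto intro: finite_subset)
  have diff: "sum f (H - essential l m H) = sum f H - sum f (essential l m H)" if "finite H"
    for f :: "nat set \<Rightarrow> real" and H m
    using that by (intro sum_diff) (auto simp: essential_def)
  have pushed: "(\<lambda>A. A - {l}) ` essential l m H \<subseteq> Pow {1..N}" if "H \<subseteq> Pow {1..N}" for H m
    using that by (auto simp: essential_def)
  have nn: "0 \<le> sum g (F - essential l i F)" "0 \<le> sum h (G - essential l j G)"
    using g h by (auto intro: sum_nonneg sliding_weight_nonneg)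
  show ?thesis
    unfolding j_def[symmetric]
  proof (rule push_arithmetic[of ?a ?b "sum g F" "sum h G" v l i j])
    show "0 < ?a" using sum_family_pos[OF g sE(1) eA] pos AB by auto
    show "0 < ?b" using sum_family_pos[OF h sE(2) eB] pos AB by auto
    show "0 < sum g F" using sum_family_pos[OF g D(1) AB(1)] pos AB by auto
    show "0 < sum h G" using sum_family_pos[OF h D(2) AB(2)] pos AB by auto
    show "0 < v" by (fact v)
    show "0 < l" using subfamily_bounds[OF D(1) AB(1,3)] by simp
    show "real l * ?a \<le> real i * sum g F" by (rule essential_le[OF g D(1) cl(1)])
    show "real l * ?b \<le> real j * sum h G" by (rule essential_le[OF h D(2) cl(2)])
    have "(sum g F + v * ?a) * sum h (G - essential l j G)
        \<le> sum g (F \<union> (\<lambda>A. A - {l}) ` essential l i F) * sum h (G - essential l j G)"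
      using weight_push[OF g D(1)] nn by (intro mult_right_mono) auto
    also have "\<dots> \<le> sum g F * sum h G"
      using D(1,2) pushed[OF D(1)] by (intro D(4) cross_push[OF ag cl D(1,2) ij]) auto
    finally show "(sum g F + v * ?a) * (sum h G - ?b) \<le> sum g F * sum h G"
      by (simp add: diff fin)
    have "sum g (F - essential l i F) * (sum h G + v * ?b)
        \<le> sum g (F - essential l i F) * sum h (G \<union> (\<lambda>A. A - {l}) ` essential l j G)"
      using weight_push[OF h D(2)] nn by (intro mult_left_mono) auto
    also have "\<dots> \<le> sum g F * sum h G"
    proof (intro D(4))
      have "cross t (G \<union> (\<lambda>A. A - {l}) ` essential l j G) (F - essential l i F)"
        using ij by (intro cross_push[OF ag' cl(2,1) D(2,1)]) simp
      then show "cross t (F - essential l i F) (G \<union> (\<lambda>A. A - {l}) ` essential l j G)"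
        by (simp add: cross_commute)
    qed (use D(1,2) pushed[OF D(2)] in auto)
    finally show "(sum g F - ?a) * (sum h G + v * ?b) \<le> sum g F * sum h G"
      by (simp add: diff fin)
  qed
qed

lemma tight_bound:
  assumes g: "sliding_weight N v g" and h: "sliding_weight N v h" and v: "0 < v"
    and mx: "maximal_pair N t g h F G"
    and pos: "\<forall>A\<in>F. 0 < g A" "\<forall>B\<in>G. 0 < h B"
    and cl: "slide_closed N F" "slide_closed N G" and ag: "agree t l F G"
    and AB: "A \<in> F" "B \<in> G" "l \<in> A" "l \<in> B" and tight: "card (A \<inter> B \<inter> {1..l}) = t"
  shows "v * (real l - real (card (A \<inter> {1..l}))) \<le> real l"
    and "v * (real l - real (card (B \<inter> {1..l}))) \<le> real l"
    and "card (A \<inter> {1..l}) + card (B \<inter> {1..l}) = l + t"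
proof -
  have ag': "agree t l G F" using ag by (simp add: agree_commute)
  have mx': "maximal_pair N t h g G F" using mx by (simp add: maximal_pair_commute)
  have tight': "card (B \<inter> A \<inter> {1..l}) = t" using tight by (simp add: Int_commute)
  show "v * (real l - real (card (A \<inter> {1..l}))) \<le> real l"
    by (rule tight_bound_right[OF h g v mx' pos(2,1) cl(2,1) ag' AB(2,1,4,3) tight'])
  show "v * (real l - real (card (B \<inter> {1..l}))) \<le> real l"
    by (rule tight_bound_right[OF g h v mx pos cl ag AB tight])
  show "card (A \<inter> {1..l}) + card (B \<inter> {1..l}) = l + t"
    by (rule tight_essential(2)[OF ag cl(1) maximal_pairD(1)[OF mx] AB tight])
qed

lemma agree_pred:
  assumes ag: "agree t l F G" "1 \<le> l"
    and no: "\<And>A B. A \<in> F \<Longrightarrow> B \<in> G \<Longrightarrow> l \<in> A \<Longrightarrow> l \<in> B \<Longrightarrow> card (A \<inter> B \<inter> {1..l}) \<noteq> t"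
  shows "agree t (l - 1) F G"
  unfolding agree_def
proof (intro ballI)
  fix A B assume AB: "A \<in> F" "B \<in> G"
  then have t: "t \<le> card (A \<inter> B \<inter> {1..l})" using ag by (auto simp: agree_def)
  have eq: "A \<inter> B \<inter> {1..l - 1} = A \<inter> B \<inter> {1..l} - {l}" using ag(2) by auto
  show "t \<le> card (A \<inter> B \<inter> {1..l - 1})"
    unfolding eq using t no[OF AB] ag(2) by (cases "l \<in> A \<and> l \<in> B") (auto simp: card_Diff_singleton)
qed

text \<open>
  A tight pair at \<open>l\<close> with trace sizes \<open>i\<close> and \<open>j\<close> satisfies $(l - i) + (l - j) = l - t$. For
  $l \geq t + 3$ the larger summand \<open>m\<close> is at least 2, and $l \leq t + 2 m$. With $v m \leq l$ this gives
  $2 (v - 2) \leq (v - 2) m \leq t$, against the hypothesis on \<open>v\<close>.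
\<close>

lemma agree_short:
  assumes g: "sliding_weight N v g" and h: "sliding_weight N v h"
    and v: "real t \<le> v" "real t + 4 < 2 * v"
    and mx: "maximal_pair N t g h F G"
    and pos: "\<forall>A\<in>F. 0 < g A" "\<forall>B\<in>G. 0 < h B"
    and cl: "slide_closed N F" "slide_closed N G"
  shows "agree t (t + 2) F G"
proof -
  note D = maximal_pairD[OF mx]
  have "agree t (t + 2 + d) F G" if "agree t (t + 2 + (d + e)) F G" for d e
    using that
  proof (induction e)
    case (Suc e)
    let ?l = "t + 2 + (d + Suc e)"
    have "agree t (?l - 1) F G"
    proof (rule agree_pred[OF Suc.prems])
      fix A B assume AB: "A \<in> F" "B \<in> G" "?l \<in> A" "?l \<in> B"
      show "card (A \<inter> B \<inter> {1..?l}) \<noteq> t"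
      proof
        assume "card (A \<inter> B \<inter> {1..?l}) = t"
        note tb = tight_bound[OF g h _ mx pos cl Suc.prems AB this]
        define m where "m = max (?l - card (A \<inter> {1..?l})) (?l - card (B \<inter> {1..?l}))"
        have v2: "2 < v" using v by simp
        have le: "card (A \<inter> {1..?l}) \<le> ?l" "card (B \<inter> {1..?l}) \<le> ?l"
          using card_mono[of "{1..?l}" "A \<inter> {1..?l}"] card_mono[of "{1..?l}" "B \<inter> {1..?l}"] by auto
        have "v * real m \<le> real ?l"
          using tb(1,2) v2 le by (auto simp: m_def max_def of_nat_diff)
        moreover have "?l \<le> t + 2 * m" "2 \<le> m" using tb(3) v2 le by (auto simp: m_def max_def)
        then have "real ?l \<le> real t + 2 * real m" "2 \<le> real m" by linarith+
        moreover have "(v - 2) * 2 \<le> (v - 2) * real m" using v2 \<open>2 \<le> real m\<close> by (intro mult_left_mono) auto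
        ultimately show False using v by (simp add: algebra_simps)
      qed
    qed simp
    then show ?case using Suc.IH by simp
  qed simp
  from this[of 0 N] have step: "agree t (t + 2 + N) F G \<Longrightarrow> agree t (t + 2) F G" by simp
  show ?thesis
  proof (rule step)
    have "A \<inter> B \<inter> {1..t + 2 + N} = A \<inter> B" if "A \<in> F" for A B
      using subfamily_bounds[OF D(1) that] by fastforce
    then show "agree t (t + 2 + N) F G" using D(3) by (auto simp: agree_def cross_def)
  qed
qed

section \<open>Comparison with stars\<close>

lemma sum_Un_le:
  fixes g :: "'a \<Rightarrow> real"
  assumes "finite A" "finite B" "\<And>x. 0 \<le> g x"
  shows "sum g (A \<union> B) \<le> sum g A + sum g B"
  using sum.union_inter[OF assms(1,2), of g] sum_nonneg[of "A \<inter> B" g] assms(3) by simp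

lemma sum_UN_le:
  fixes g :: "'a \<Rightarrow> real"
  assumes "finite I" "\<And>i. i \<in> I \<Longrightarrow> finite (U i)" "\<And>x. 0 \<le> g x"
  shows "sum g (\<Union>i\<in>I. U i) \<le> (\<Sum>i\<in>I. sum g (U i))"
  using assms
proof (induction I)
  case (insert i I)
  have "sum g (\<Union>j\<in>insert i I. U j) \<le> sum g (U i) + sum g (\<Union>j\<in>I. U j)"
    using insert.prems insert.hyps sum_Un_le[of "U i" "\<Union>j\<in>I. U j" g] by auto
  moreover have "sum g (\<Union>j\<in>I. U j) \<le> (\<Sum>j\<in>I. sum g (U j))"
    using insert.prems by (intro insert.IH) auto
  ultimately show ?case using insert.hyps by simp
qed simp

lemma finite_star: "finite (star N T)"
  by (auto simp: star_def intro: finite_subset[of _ "Pow {1..N}"])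

lemma star_insert_le:
  assumes g: "sliding_weight N v g" and "x \<notin> T"
  shows "(v + 1) * sum g (star N (insert x T)) \<le> sum g (star N T)"
proof -
  let ?R = "{X \<in> star N T. x \<notin> X}"
  have "v * sum g (star N (insert x T)) \<le> sum g ?R"
    using assms(2) by (intro weight_delete_family[OF g, where x = x]) (auto simp: star_def)
  moreover have "sum g (star N T) = sum g (star N (insert x T) \<union> ?R)"
    by (intro arg_cong[where f = "sum g"]) (auto simp: star_def)
  moreover have "\<dots> = sum g (star N (insert x T)) + sum g ?R"
    by (intro sum.union_disjoint) (auto simp: finite_star star_def)
  ultimately show ?thesis by (simp add: algebra_simps)
qed

text \<open>
  For \<open>p \<le> t\<close> these are the sets outside the star of
  \<open>{1..t}\<close> that the competing configurations on \<open>l = t + 1\<close> and \<open>l = t + 2\<close> points may contain.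
\<close>

definition near_star :: "nat \<Rightarrow> nat \<Rightarrow> nat \<Rightarrow> nat set set" where
  "near_star N l p = {X. X \<subseteq> {1..N} \<and> {1..l} - {p} \<subseteq> X \<and> p \<notin> X}"

text \<open>
  Moving \<open>t + 1\<close> to the missing element \<open>p\<close> maps the near-star into the part of the star of \<open>{1..t}\<close>
  whose trace on \<open>{1..l}\<close> misses only \<open>t + 1\<close>.
\<close>

lemma near_star_le:
  assumes g: "sliding_weight N v g" and p: "p \<in> {1..t}" and l: "t < l"
  shows "sum g (near_star N l p) \<le> sum g {X \<in> star N ({1..l} - {t + 1}). t + 1 \<notin> X}"
proof (rule weight_slide_family[OF g, where p = p and q = "t + 1"])
  have next_mem: "t + 1 \<in> {1..l} - {p}" using p l by auto
  show "(\<lambda>X. insert p (X - {t + 1})) ` near_star N l p \<subseteq> {X \<in> star N ({1..l} - {t + 1}). t + 1 \<notin> X}"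
  proof
    fix Y assume "Y \<in> (\<lambda>X. insert p (X - {t + 1})) ` near_star N l p"
    then obtain X where X: "Y = insert p (X - {t + 1})" "X \<subseteq> {1..N}" "{1..l} - {p} \<subseteq> X"
      by (auto simp: near_star_def)
    have "t + 1 \<in> X" using X(3) next_mem by blast
    then have "t + 1 \<in> {1..N}" using X(2) by blast
    then have "p \<in> {1..N}" using p by simp
    then have "Y \<subseteq> {1..N}" using X(1,2) by blast
    moreover have "{1..l} - {t + 1} \<subseteq> Y" using X by blast
    moreover have "t + 1 \<notin> Y" using X p by auto
    ultimately show "Y \<in> {X \<in> star N ({1..l} - {t + 1}). t + 1 \<notin> X}" by (simp add: star_def)
  qed
  show "\<forall>X\<in>near_star N l p. t + 1 \<in> X \<and> p \<notin> X" using next_mem unfolding near_star_def by blast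
  show "1 \<le> p" "p < t + 1" using p by auto
  show "near_star N l p \<subseteq> Pow {1..N}" unfolding near_star_def by blast
  show "{X \<in> star N ({1..l} - {t + 1}). t + 1 \<notin> X} \<subseteq> Pow {1..N}" unfolding star_def by blast
qed

lemma near_star_cover_le:
  assumes g: "sliding_weight N v g" and F: "F \<subseteq> S \<union> (\<Union>p\<in>{1..t}. near_star N l p)"
    and S: "finite S" and l: "t < l"
  shows "sum g F \<le> sum g S + real t * sum g {X \<in> star N ({1..l} - {t + 1}). t + 1 \<notin> X}"
proof -
  have fin: "finite (near_star N l p)" for p
  proof (rule finite_subset)
    show "near_star N l p \<subseteq> Pow {1..N}" unfolding near_star_def by blast
  qed simp
  have "sum g F \<le> sum g (S \<union> (\<Union>p\<in>{1..t}. near_star N l p))"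
    using F S fin by (intro sum_mono2 sliding_weight_nonneg[OF g]) auto
  also have "\<dots> \<le> sum g S + sum g (\<Union>p\<in>{1..t}. near_star N l p)"
    using S fin by (intro sum_Un_le sliding_weight_nonneg[OF g]) auto
  also have "sum g (\<Union>p\<in>{1..t}. near_star N l p) \<le> (\<Sum>p\<in>{1..t}. sum g (near_star N l p))"
    using fin by (intro sum_UN_le sliding_weight_nonneg[OF g]) auto
  also have "\<dots> \<le> (\<Sum>p\<in>{1..t}. sum g {X \<in> star N ({1..l} - {t + 1}). t + 1 \<notin> X})"
    using l by (intro sum_mono near_star_le[OF g]) auto
  finally show ?thesis by simp
qed

definition star_bound :: "nat \<Rightarrow> nat \<Rightarrow> real \<Rightarrow> (nat set \<Rightarrow> real) \<Rightarrow> (nat set \<Rightarrow> real) \<Rightarrow> nat set set \<Rightarrow> nat set set \<Rightarrow> bool" where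
  "star_bound N t v g h F G \<longleftrightarrow>
    sum g F * sum h G \<le> sum g (star N {1..t}) * sum h (star N {1..t}) \<and>
    (real t < v \<longrightarrow> sum g F * sum h G = sum g (star N {1..t}) * sum h (star N {1..t})
       \<longrightarrow> F \<subseteq> star N {1..t} \<and> G \<subseteq> star N {1..t})"

lemma star_bound_commute: "star_bound N t v g h F G \<longleftrightarrow> star_bound N t v h g G F"
  unfolding star_bound_def by (auto simp: mult.commute)

lemma star_pos:
  assumes "sliding_weight N v g" "0 < g {1..t}" "t \<le> N"
  shows "0 < sum g (star N {1..t})"
  using assms by (intro sum_family_pos[where A = "{1..t}"]) (auto simp: star_def)

lemma star_bound_stars:
  assumes g: "sliding_weight N v g" and h: "sliding_weight N v h"
    and "F \<subseteq> star N {1..t}" "G \<subseteq> star N {1..t}"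
  shows "star_bound N t v g h F G"
proof -
  have "sum g F \<le> sum g (star N {1..t})" "sum h G \<le> sum h (star N {1..t})"
    using assms by (auto intro!: sum_mono2 finite_star intro: sliding_weight_nonneg)
  moreover have "0 \<le> sum h G" "0 \<le> sum g (star N {1..t})"
    using g h by (auto intro!: sum_nonneg intro: sliding_weight_nonneg)
  ultimately show ?thesis using assms by (auto simp: star_bound_def intro!: mult_mono)
qed

text \<open>
  The configuration on \<open>t + 1\<close> points: some \<open>A \<in> F\<close> misses a point \<open>p\<close> of \<open>{1..t}\<close>. All partners of
  \<open>A\<close> contain the rest of \<open>{1..t + 1}\<close>, and the partners of the set obtained by moving \<open>t + 1\<close> to \<open>p\<close>
  contain \<open>p\<close>. Therefore \<open>G\<close> consists of supersets of \<open>{1..t + 1}\<close> and has at most the fraction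
  $1 / (v + 1)$ of the weight of the star, while \<open>F\<close> can exceed it by the factor $t + 1$ at most. The
  product of these factors is at most 1 as $v \geq t$.
\<close>

lemma star_bound_Suc:
  assumes g: "sliding_weight N v g" and h: "sliding_weight N v h" and v: "real t \<le> v"
    and sub: "F \<subseteq> Pow {1..N}" "G \<subseteq> Pow {1..N}" and ne: "G \<noteq> {}"
    and pos: "0 < g {1..t}" "0 < h {1..t}" "t \<le> N"
    and cl: "slide_closed N F" and ag: "agree t (t + 1) F G" and F: "\<not> F \<subseteq> star N {1..t}"
  shows "star_bound N t v g h F G"
proof -
  define \<alpha> where "\<alpha> = sum g (star N {1..t})"
  define \<beta> where "\<beta> = sum h (star N {1..t})"
  have \<alpha>\<beta>: "0 < \<alpha>" "0 < \<beta>" using star_pos[OF g] star_pos[OF h] pos by (auto simp: \<alpha>_def \<beta>_def)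
  have miss: "{1..t + 1} - {p} \<subseteq> A \<inter> B" if "A \<in> F" "B \<in> G" "p \<notin> A" "p \<in> {1..t}" for A B p
  proof -
    have "A \<inter> B \<inter> {1..t + 1} = {1..t + 1} - {p}"
      using that ag by (intro card_seteq) (auto simp: agree_def)
    then show ?thesis by auto
  qed
  obtain A where "A \<in> F" "A \<notin> star N {1..t}" using F by blast
  then have "\<not> {1..t} \<subseteq> A" using sub(1) unfolding star_def by blast
  then obtain p where A: "A \<in> F" "p \<in> {1..t}" "p \<notin> A" using \<open>A \<in> F\<close> by blast
  have "G \<subseteq> star N (insert (t + 1) {1..t})"
  proof
    fix B assume B: "B \<in> G"
    note m = miss[OF A(1) B A(3,2)]
    have "t + 1 \<in> A" "t + 1 \<in> B" using m A(2) by force+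
    then have "insert p (A - {t + 1}) \<in> F"
      using slide_closedD[OF cl sub(1) A(1) _ A(3)] A(2) by auto
    then have "insert p (A - {t + 1}) \<inter> B \<inter> {1..t + 1} = {1..t}"
      using ag B A(2) by (intro card_seteq) (auto simp: agree_def not_less_eq_eq)
    then show "B \<in> star N (insert (t + 1) {1..t})" using \<open>t + 1 \<in> B\<close> B sub(2) by (auto simp: star_def)
  qed
  then have "(v + 1) * sum h G \<le> (v + 1) * sum h (star N (insert (t + 1) {1..t}))"
    using v by (intro mult_left_mono sum_mono2 finite_star sliding_weight_nonneg[OF h]) auto
  also have "\<dots> \<le> \<beta>" unfolding \<beta>_def by (intro star_insert_le[OF h]) auto
  finally have G: "(v + 1) * sum h G \<le> \<beta>" .
  obtain B where B: "B \<in> G" using ne by blast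
  have "F \<subseteq> star N {1..t} \<union> (\<Union>p\<in>{1..t}. near_star N (t + 1) p)"
  proof
    fix A assume A: "A \<in> F"
    show "A \<in> star N {1..t} \<union> (\<Union>p\<in>{1..t}. near_star N (t + 1) p)"
    proof (cases "{1..t} \<subseteq> A")
      case False
      then obtain p where "p \<in> {1..t}" "p \<notin> A" by blast
      then show ?thesis using miss[OF A B] A sub(1) by (force simp: near_star_def)
    qed (use A sub in \<open>auto simp: star_def\<close>)
  qed
  from near_star_cover_le[OF g this finite_star]
  have "sum g F \<le> \<alpha> + real t * sum g {X \<in> star N ({1..t + 1} - {t + 1}). t + 1 \<notin> X}"
    by (simp add: \<alpha>_def)
  also have "\<dots> \<le> \<alpha> + real t * \<alpha>"
    unfolding \<alpha>_def by (intro add_left_mono mult_left_mono sum_mono2 finite_star sliding_weight_nonneg[OF g])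
      (auto simp: star_def)
  finally have F': "sum g F \<le> (1 + real t) * \<alpha>" by (simp add: algebra_simps)
  have nn: "0 \<le> sum h G" by (intro sum_nonneg sliding_weight_nonneg[OF h])
  have "(v + 1) * (sum g F * sum h G) = sum g F * ((v + 1) * sum h G)" by simp
  also have "\<dots> \<le> ((1 + real t) * \<alpha>) * \<beta>" using F' G nn v \<alpha>\<beta> by (intro mult_mono) auto
  finally have main: "(v + 1) * (sum g F * sum h G) \<le> (1 + real t) * (\<alpha> * \<beta>)" by simp
  have "0 < \<alpha> * \<beta>" using \<alpha>\<beta> by simp
  have "(1 + real t) * (\<alpha> * \<beta>) \<le> (v + 1) * (\<alpha> * \<beta>)"
    using \<alpha>\<beta> v by (intro mult_right_mono) auto
  with main have "(v + 1) * (sum g F * sum h G) \<le> (v + 1) * (\<alpha> * \<beta>)" by linarith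
  moreover have "sum g F * sum h G \<noteq> \<alpha> * \<beta>" if "real t < v"
  proof
    assume "sum g F * sum h G = \<alpha> * \<beta>"
    moreover have "(1 + real t) * (\<alpha> * \<beta>) < (v + 1) * (\<alpha> * \<beta>)"
      using that \<open>0 < \<alpha> * \<beta>\<close> by (intro mult_strict_right_mono) auto
    ultimately show False using main by simp
  qed
  ultimately show ?thesis using v unfolding star_bound_def \<alpha>_def[symmetric] \<beta>_def[symmetric] by auto
qed

text \<open>
  \<open>Z\<close> collects the sets of the star whose trace on \<open>{1..t + 2}\<close> is exactly \<open>{1..t}\<close>, and \<open>V\<close> those with
  trace \<open>{1..t} \<union> {t + 2}\<close>. Deleting \<open>t + 2\<close> compares \<open>V\<close> with \<open>Z\<close>; deleting \<open>t + 1\<close> compares the rest of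
  the star with \<open>V \<union> Z\<close>. Hence \<open>Z\<close> carries at least the fraction $(v / (v + 1))^2$ of the star.
\<close>

lemma star_split_le:
  fixes t :: nat
  assumes g: "sliding_weight N v g" and v: "0 \<le> v"
  defines "V \<equiv> {X \<in> star N ({1..t + 2} - {t + 1}). t + 1 \<notin> X}"
    and "Z \<equiv> {X \<in> star N {1..t}. t + 1 \<notin> X \<and> t + 2 \<notin> X}"
  shows "v * sum g V \<le> sum g Z" "sum g V + sum g Z \<le> sum g (star N {1..t})"
    "v\<^sup>2 * sum g (star N {1..t}) \<le> (v + 1)\<^sup>2 * sum g Z"
    "sum g (star N {1..t} - Z) = sum g (star N {1..t}) - sum g Z"
proof -
  let ?S = "star N {1..t}"
  have VS: "V \<subseteq> ?S" by (auto simp: V_def star_def)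
  have ZS: "Z \<subseteq> ?S" by (auto simp: Z_def)
  have fin: "finite V" "finite Z" using VS ZS finite_star finite_subset by blast+
  have V2: "\<forall>X\<in>V. t + 2 \<in> X" by (auto simp: V_def star_def)
  show vV: "v * sum g V \<le> sum g Z"
  proof (rule weight_delete_family[OF g _ V2])
    show "V \<subseteq> Pow {1..N}" "Z \<subseteq> Pow {1..N}" using VS ZS unfolding star_def by blast+
    show "(\<lambda>X. X - {t + 2}) ` V \<subseteq> Z"
    proof
      fix Y assume "Y \<in> (\<lambda>X. X - {t + 2}) ` V"
      then obtain X where X: "Y = X - {t + 2}" "X \<in> V" by blast
      then have "X \<subseteq> {1..N}" "{1..t} \<subseteq> X" "t + 1 \<notin> X" using VS by (auto simp: V_def star_def)
      then show "Y \<in> Z" using X(1) by (auto simp: Z_def star_def)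
    qed
  qed
  have disj: "sum g V + sum g Z = sum g (V \<union> Z)"
    using fin V2 by (intro sum.union_disjoint[symmetric]) (auto simp: Z_def)
  also have "\<dots> \<le> sum g ?S"
    using VS ZS by (intro sum_mono2 finite_star sliding_weight_nonneg[OF g]) auto
  finally show "sum g V + sum g Z \<le> sum g ?S" .
  show "sum g (?S - Z) = sum g ?S - sum g Z" using ZS by (intro sum_diff finite_star)
  have VZ: "V \<union> Z = {X \<in> ?S. t + 1 \<notin> X}"
  proof (intro equalityI subsetI)
    fix X assume "X \<in> {X \<in> ?S. t + 1 \<notin> X}"
    then have X: "X \<subseteq> {1..N}" "{1..t} \<subseteq> X" "t + 1 \<notin> X" by (auto simp: star_def)
    have "{1..t + 2} - {t + 1} = insert (t + 2) {1..t}" by auto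
    then show "X \<in> V \<union> Z" using X by (auto simp: V_def Z_def star_def)
  qed (use VS ZS in \<open>auto simp: V_def Z_def\<close>)
  have "v * sum g (?S - (V \<union> Z)) \<le> sum g (V \<union> Z)"
    unfolding VZ by (intro weight_delete_family[OF g, where x = "t + 1"]) (auto simp: star_def)
  moreover have "sum g (?S - (V \<union> Z)) = sum g ?S - sum g (V \<union> Z)"
    using VS ZS by (intro sum_diff finite_star) auto
  ultimately have "v * (sum g ?S - (sum g V + sum g Z)) \<le> sum g V + sum g Z" by (metis disj)
  then have "v * sum g ?S \<le> (v + 1) * (sum g V + sum g Z)" by (simp add: algebra_simps)
  then have "v * (v * sum g ?S) \<le> v * ((v + 1) * (sum g V + sum g Z))"
    using v by (intro mult_left_mono) auto
  also have "\<dots> = (v + 1) * (v * sum g V + v * sum g Z)" by (simp add: algebra_simps)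
  also have "\<dots> \<le> (v + 1) * (sum g Z + v * sum g Z)" using vV v by (intro mult_left_mono) auto
  finally show "v\<^sup>2 * sum g ?S \<le> (v + 1)\<^sup>2 * sum g Z" by (simp add: power2_eq_square algebra_simps)
qed

text \<open>
  The configuration on \<open>t + 2\<close> points in which some trace \<open>A0\<close> has size exactly \<open>t\<close>, while some \<open>B0\<close>
  has a trace of size \<open>t + 1\<close> containing \<open>t + 2\<close>. All members of \<open>G\<close> contain the trace of \<open>A0\<close>, and
  as \<open>F\<close> is closed they contain \<open>{1..t}\<close>. So \<open>B0\<close> has trace \<open>{1..t} \<union> {t + 2}\<close>, and \<open>{1..t + 1}\<close> is a
  trace of \<open>G\<close> as well. Either \<open>{1..t}\<close> is also a trace of \<open>G\<close> and both families lie in the star, or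
  \<open>G\<close> loses the dominant part \<open>Z\<close> of the star and \<open>F\<close> gains only sets that miss one of the first \<open>t\<close>
  of the \<open>t + 2\<close> points. The resulting factor is at most $(2 v + 1)^2 / (v + 1)^3 < 1$.
\<close>

lemma star_bound_Suc_Suc:
  assumes g: "sliding_weight N v g" and h: "sliding_weight N v h" and v: "real t \<le> v" "2 \<le> v"
    and sub: "F \<subseteq> Pow {1..N}" "G \<subseteq> Pow {1..N}"
    and pos: "0 < g {1..t}" "0 < h {1..t}" "t \<le> N"
    and cl: "slide_closed N F" "slide_closed N G" and ag: "agree t (t + 2) F G"
    and A0: "A0 \<in> F" "card (A0 \<inter> {1..t + 2}) = t"
    and B0: "B0 \<in> G" "card (B0 \<inter> {1..t + 2}) = t + 1" "t + 2 \<in> B0"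
  shows "star_bound N t v g h F G"
proof -
  define Z where "Z = {X \<in> star N {1..t}. t + 1 \<notin> X \<and> t + 2 \<notin> X}"
  define \<alpha> where "\<alpha> = sum g (star N {1..t})"
  define \<beta> where "\<beta> = sum h (star N {1..t})"
  have \<alpha>\<beta>: "0 < \<alpha>" "0 < \<beta>" using star_pos[OF g] star_pos[OF h] pos by (auto simp: \<alpha>_def \<beta>_def)
  have tail: "{1..t + 2} = insert (t + 1) (insert (t + 2) {1..t})" by auto
  have G: "{1..t} \<subseteq> B" if B: "B \<in> G" for B
  proof (rule ccontr)
    assume "\<not> {1..t} \<subseteq> B"
    then obtain p where p: "p \<in> {1..t}" "p \<notin> B" by blast
    have "A0 \<inter> B \<inter> {1..t + 2} = A0 \<inter> {1..t + 2}"
      using ag A0 B by (intro card_seteq) (auto simp: agree_def)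
    then have TB: "A0 \<inter> {1..t + 2} \<subseteq> B" by auto
    then have pA: "p \<notin> A0" using p by auto
    have "\<exists>q \<in> A0 \<inter> {1..t + 2}. t < q"
    proof (rule ccontr)
      assume "\<not> ?thesis"
      then have "x \<in> {1..t} - {p}" if "x \<in> A0 \<inter> {1..t + 2}" for x
        using pA that by (cases "x = p") (auto simp: not_less)
      then have "A0 \<inter> {1..t + 2} \<subseteq> {1..t} - {p}" by blast
      then have "card (A0 \<inter> {1..t + 2}) \<le> card ({1..t} - {p})" by (intro card_mono) auto
      moreover have "card ({1..t} - {p}) = t - 1" "1 \<le> t" using p by auto
      ultimately show False using A0(2) by linarith
    qed
    then obtain q where q: "q \<in> A0" "q \<in> {1..t + 2}" "t < q" by auto
    have "insert p (A0 - {q}) \<in> F"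
      using slide_closedD[OF cl(1) sub(1) A0(1) q(1) pA] p q by auto
    then have "t \<le> card (insert p (A0 - {q}) \<inter> B \<inter> {1..t + 2})" using ag B by (auto simp: agree_def)
    also have "\<dots> \<le> card (A0 \<inter> {1..t + 2} - {q})" using p by (intro card_mono) auto
    also have "\<dots> < card (A0 \<inter> {1..t + 2})" using q by (intro card_Diff1_less) auto
    finally show False using A0 by simp
  qed
  show ?thesis
  proof (cases "\<exists>B\<in>G. t + 1 \<notin> B \<and> t + 2 \<notin> B")
    case True
    then obtain B where B: "B \<in> G" "t + 1 \<notin> B" "t + 2 \<notin> B" by blast
    have "A \<in> star N {1..t}" if "A \<in> F" for A
    proof -
      have "A \<inter> B \<inter> {1..t + 2} = {1..t}"
      proof (rule card_seteq)
        show "A \<inter> B \<inter> {1..t + 2} \<subseteq> {1..t}" unfolding tail using B by auto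
      qed (use ag that B in \<open>auto simp: agree_def\<close>)
      then show ?thesis using that sub by (auto simp: star_def)
    qed
    moreover have "G \<subseteq> star N {1..t}" using G sub by (auto simp: star_def)
    ultimately show ?thesis by (intro star_bound_stars[OF g h]) auto
  next
    case False
    then have GZ: "G \<subseteq> star N {1..t} - Z" using G sub by (auto simp: star_def Z_def)
    have B0': "t + 1 \<notin> B0"
    proof
      assume "t + 1 \<in> B0"
      then have "B0 \<inter> {1..t + 2} = {1..t + 2}" unfolding tail using G[OF B0(1)] B0(3) by blast
      then show False using B0(2) by simp
    qed
    have B1: "insert (t + 1) (B0 - {t + 2}) \<in> G"
      using slide_closedD[OF cl(2) sub(2) B0(1,3) B0'] by simp
    have "F \<subseteq> star N {1..t} \<union> (\<Union>p\<in>{1..t}. near_star N (t + 2) p)"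
    proof
      fix A assume A: "A \<in> F"
      show "A \<in> star N {1..t} \<union> (\<Union>p\<in>{1..t}. near_star N (t + 2) p)"
      proof (cases "{1..t} \<subseteq> A")
        case False
        then obtain p where p: "p \<in> {1..t}" "p \<notin> A" by blast
        have "A \<inter> B0 \<inter> {1..t + 2} = insert (t + 2) ({1..t} - {p})"
        proof (rule card_seteq)
          show "A \<inter> B0 \<inter> {1..t + 2} \<subseteq> insert (t + 2) ({1..t} - {p})"
            unfolding tail using p B0' by auto
        qed (use ag A B0 p in \<open>auto simp: agree_def card_insert_if\<close>)
        moreover have "A \<inter> insert (t + 1) (B0 - {t + 2}) \<inter> {1..t + 2} = insert (t + 1) ({1..t} - {p})"
        proof (rule card_seteq)
          show "A \<inter> insert (t + 1) (B0 - {t + 2}) \<inter> {1..t + 2} \<subseteq> insert (t + 1) ({1..t} - {p})"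
            unfolding tail using p by auto
        qed (use ag A B1 p in \<open>auto simp: agree_def card_insert_if\<close>)
        ultimately have "{1..t + 2} - {p} \<subseteq> A" unfolding tail by auto
        then show ?thesis using p A sub by (auto simp: near_star_def)
      qed (use A sub in \<open>auto simp: star_def\<close>)
    qed
    from near_star_cover_le[OF g this finite_star]
    have 1: "sum g F \<le> \<alpha> + real t * sum g {X \<in> star N ({1..t + 2} - {t + 1}). t + 1 \<notin> X}"
      (is "_ \<le> _ + _ * ?w") by (simp add: \<alpha>_def)
    have v0: "0 \<le> v" using v by simp
    note sg = star_split_le[OF g v0, of t, folded Z_def \<alpha>_def] and sh = star_split_le[OF h v0, of t, folded Z_def \<beta>_def]
    have 2: "(v + 1) * ?w \<le> \<alpha>" using sg(1,2) by (simp add: algebra_simps)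
    have w0: "0 \<le> ?w" by (intro sum_nonneg sliding_weight_nonneg[OF g])
    have "real t * ?w \<le> v * ?w" using v w0 by (intro mult_right_mono)
    then have "sum g F \<le> \<alpha> + v * ?w" using 1 by linarith
    then have "(v + 1) * sum g F \<le> (v + 1) * (\<alpha> + v * ?w)" using v by (intro mult_left_mono) auto
    also have "\<dots> = (v + 1) * \<alpha> + v * ((v + 1) * ?w)" by (simp add: algebra_simps)
    also have "\<dots> \<le> (v + 1) * \<alpha> + v * \<alpha>" using 2 v by (intro add_left_mono mult_left_mono) auto
    finally have F': "(v + 1) * sum g F \<le> (2 * v + 1) * \<alpha>" by (simp add: algebra_simps)
    have "sum h G \<le> sum h (star N {1..t} - Z)"
      using GZ by (intro sum_mono2 sliding_weight_nonneg[OF h]) (auto intro: finite_star)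
    then have "sum h G \<le> \<beta> - sum h Z" using sh(4) by simp
    then have "(v + 1)\<^sup>2 * sum h G \<le> (v + 1)\<^sup>2 * (\<beta> - sum h Z)" by (intro mult_left_mono) auto
    also have "\<dots> \<le> (v + 1)\<^sup>2 * \<beta> - v\<^sup>2 * \<beta>" using sh(3) by (simp add: algebra_simps)
    finally have G': "(v + 1)\<^sup>2 * sum h G \<le> (2 * v + 1) * \<beta>" by (simp add: power2_eq_square algebra_simps)
    have nn: "0 \<le> sum h G" by (intro sum_nonneg sliding_weight_nonneg[OF h])
    have "(v + 1) * (v + 1)\<^sup>2 * (sum g F * sum h G) = ((v + 1) * sum g F) * ((v + 1)\<^sup>2 * sum h G)" by simp
    also have "\<dots> \<le> ((2 * v + 1) * \<alpha>) * ((2 * v + 1) * \<beta>)"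
      using nn v \<alpha>\<beta> by (intro mult_mono[OF F' G']) auto
    also have "\<dots> = (2 * v + 1)\<^sup>2 * (\<alpha> * \<beta>)" by (simp add: power2_eq_square)
    also have "\<dots> < (v + 1) * (v + 1)\<^sup>2 * (\<alpha> * \<beta>)"
    proof (rule mult_strict_right_mono)
      have "2 * v \<le> v * v" using v by (intro mult_right_mono) auto
      then have "v + 1 < v * v" using v by linarith
      then have "v * (v + 1) < v * (v * v)" using v by (intro mult_strict_left_mono) auto
      then show "(2 * v + 1)\<^sup>2 < (v + 1) * (v + 1)\<^sup>2" by (simp add: power2_eq_square algebra_simps)
    qed (use \<alpha>\<beta> in simp)
    finally have "sum g F * sum h G < \<alpha> * \<beta>" using v by simp
    then show ?thesis by (simp add: star_bound_def \<alpha>_def \<beta>_def)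
  qed
qed

text \<open>
  A family all of whose traces on \<open>{1..t + 2}\<close> have size at least \<open>t + 1\<close> does not exceed the weight of
  the star: compared with the star it lacks \<open>Z\<close> and has at most \<open>t\<close> additional near-stars, each of at
  most $1 / v$ times the weight of \<open>Z\<close>.
\<close>

lemma heavy_traces_le:
  assumes g: "sliding_weight N v g" and v: "real t \<le> v"
    and F: "F \<subseteq> Pow {1..N}" "\<And>A. A \<in> F \<Longrightarrow> t + 1 \<le> card (A \<inter> {1..t + 2})"
  shows "sum g F \<le> sum g (star N {1..t})"
    and "real t < v \<Longrightarrow> 0 < g {1..t} \<Longrightarrow> t \<le> N \<Longrightarrow> sum g F < sum g (star N {1..t})"
proof -
  define Z where "Z = {X \<in> star N {1..t}. t + 1 \<notin> X \<and> t + 2 \<notin> X}"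
  define w where "w = sum g {X \<in> star N ({1..t + 2} - {t + 1}). t + 1 \<notin> X}"
  have v0: "0 \<le> v" using v by linarith
  note sg = star_split_le[OF g v0, of t, folded Z_def w_def]
  have "F \<subseteq> (star N {1..t} - Z) \<union> (\<Union>p\<in>{1..t}. near_star N (t + 2) p)"
  proof
    fix A assume A: "A \<in> F"
    have miss: "{1..t + 2} - {p} \<subseteq> A" if "p \<notin> A" "p \<in> {1..t + 2}" for p
    proof -
      have "A \<inter> {1..t + 2} = {1..t + 2} - {p}"
        using F(2)[OF A] that by (intro card_seteq) auto
      then show ?thesis by auto
    qed
    show "A \<in> (star N {1..t} - Z) \<union> (\<Union>p\<in>{1..t}. near_star N (t + 2) p)"
    proof (cases "{1..t} \<subseteq> A")
      case True
      then have "A \<notin> Z" using miss[of "t + 1"] by (force simp: Z_def)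
      then show ?thesis using True A F(1) by (auto simp: star_def)
    next
      case False
      then obtain p where p: "p \<in> {1..t}" "p \<notin> A" by blast
      then show ?thesis using miss[of p] A F(1) by (auto simp: near_star_def)
    qed
  qed
  from near_star_cover_le[OF g this]
  have 1: "sum g F \<le> sum g (star N {1..t}) - sum g Z + real t * w"
    using sg(4) by (simp add: w_def finite_star)
  have w0: "0 \<le> w" unfolding w_def by (intro sum_nonneg sliding_weight_nonneg[OF g])
  have "real t * w \<le> v * w" using v w0 by (intro mult_right_mono)
  then show "sum g F \<le> sum g (star N {1..t})" using 1 sg(1) by linarith
  assume s: "real t < v" "0 < g {1..t}" "t \<le> N"
  have Z: "0 < sum g Z"
    using s by (intro sum_family_pos[OF g, where A = "{1..t}"]) (auto simp: Z_def star_def)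
  show "sum g F < sum g (star N {1..t})"
  proof (cases "w = 0")
    case False
    then have "real t * w < v * w" using s w0 by (intro mult_strict_right_mono) auto
    then show ?thesis using 1 sg(1) by linarith
  qed (use 1 Z in simp)
qed

text \<open>
  Members share \<open>t\<close> elements within \<open>{1..t + 2}\<close>. If even \<open>{1..t + 1}\<close> suffices, \<open>star_bound_Suc\<close>
  applies. Otherwise there is a tight pair at \<open>t + 2\<close>, and \<open>tight_bound\<close> excludes the trace sizes
  \<open>t\<close> and \<open>t + 2\<close>, so that both traces have size \<open>t + 1\<close>.
\<close>

lemma star_bound_closed:
  assumes g: "sliding_weight N v g" and h: "sliding_weight N v h"
    and v: "real t \<le> v" "real t + 4 < 2 * v"
    and tpos: "0 < g {1..t}" "0 < h {1..t}" "t \<le> N"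
    and mx: "maximal_pair N t g h F G"
    and pos: "\<forall>A\<in>F. 0 < g A" "\<forall>B\<in>G. 0 < h B"
    and cl: "slide_closed N F" "slide_closed N G"
  shows "star_bound N t v g h F G"
proof (cases "F = {} \<or> G = {} \<or> F \<subseteq> star N {1..t} \<and> G \<subseteq> star N {1..t}")
  case True
  moreover have "0 < sum g (star N {1..t}) * sum h (star N {1..t})"
    using star_pos[OF g tpos(1,3)] star_pos[OF h tpos(2,3)] by simp
  ultimately show ?thesis
    using star_bound_stars[OF g h, of F t G] by (elim disjE) (auto simp: star_bound_def)
next
  case nontriv: False
  note D = maximal_pairD[OF mx]
  have v2: "2 \<le> v" "0 < v" using v by auto
  have ag2: "agree t (t + 2) F G" by (rule agree_short[OF g h v mx pos cl])
  show ?thesis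
  proof (cases "agree t (t + 1) F G")
    case True
    show ?thesis
    proof (cases "F \<subseteq> star N {1..t}")
      case False
      then show ?thesis using nontriv by (intro star_bound_Suc[OF g h v(1) D(1,2) _ tpos cl(1) True]) auto
    next
      case F: True
      have "star_bound N t v h g G F"
        using nontriv F True
        by (intro star_bound_Suc[OF h g v(1) D(2,1) _ tpos(2,1,3) cl(2)]) (auto simp: agree_commute)
      then show ?thesis by (simp add: star_bound_commute)
    qed
  next
    case False
    then obtain A B where AB: "A \<in> F" "B \<in> G" "t + 2 \<in> A" "t + 2 \<in> B"
      and tight: "card (A \<inter> B \<inter> {1..t + 2}) = t"
      using agree_pred[OF ag2] by fastforce
    note tb = tight_bound[OF g h v2(2) mx pos cl ag2 AB tight]
    have small: "t + 1 \<le> m" if "v * (real (t + 2) - real m) \<le> real (t + 2)" for m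
    proof (rule ccontr)
      assume "\<not> t + 1 \<le> m"
      then have "v * 2 \<le> v * (real (t + 2) - real m)" using v2 by (intro mult_left_mono) auto
      then have "v * 2 \<le> real (t + 2)" using that by (rule order_trans)
      then show False using v by simp
    qed
    have cAB: "card (A \<inter> {1..t + 2}) = t + 1" "card (B \<inter> {1..t + 2}) = t + 1"
      using small[OF tb(1)] small[OF tb(2)] tb(3) by auto
    have ag2': "agree t (t + 2) G F" using ag2 by (simp add: agree_commute)
    consider (F) A0 where "A0 \<in> F" "card (A0 \<inter> {1..t + 2}) = t"
      | (G) B0 where "B0 \<in> G" "card (B0 \<inter> {1..t + 2}) = t"
      | (none) "\<And>A. A \<in> F \<Longrightarrow> card (A \<inter> {1..t + 2}) \<noteq> t" "\<And>B. B \<in> G \<Longrightarrow> card (B \<inter> {1..t + 2}) \<noteq> t"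
      by blast
    then show ?thesis
    proof cases
      case F
      show ?thesis
        by (rule star_bound_Suc_Suc[OF g h v(1) v2(1) D(1,2) tpos cl ag2 F AB(2) cAB(2) AB(4)])
    next
      case G
      have "star_bound N t v h g G F"
        by (rule star_bound_Suc_Suc[OF h g v(1) v2(1) D(2,1) tpos(2,1,3) cl(2,1) ag2' G AB(1) cAB(1) AB(3)])
      then show ?thesis by (simp add: star_bound_commute)
    next
      case none
      have t_le: "t \<le> card (A \<inter> {1..t + 2})" "t \<le> card (B \<inter> {1..t + 2})" if "A \<in> F" "B \<in> G" for A B
      proof -
        have "t \<le> card (A \<inter> B \<inter> {1..t + 2})" using ag2 that by (auto simp: agree_def)
        moreover have "card (A \<inter> B \<inter> {1..t + 2}) \<le> card (A \<inter> {1..t + 2})"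
          "card (A \<inter> B \<inter> {1..t + 2}) \<le> card (B \<inter> {1..t + 2})" by (auto intro!: card_mono)
        ultimately show "t \<le> card (A \<inter> {1..t + 2})" "t \<le> card (B \<inter> {1..t + 2})" by linarith+
      qed
      have hF: "t + 1 \<le> card (X \<inter> {1..t + 2})" if "X \<in> F" for X
        using none(1)[OF that] t_le(1)[OF that AB(2)] by simp
      have hG: "t + 1 \<le> card (X \<inter> {1..t + 2})" if "X \<in> G" for X
        using none(2)[OF that] t_le(2)[OF AB(1) that] by simp
      note Fle = heavy_traces_le[OF g v(1) D(1) hF] and Gle = heavy_traces_le[OF h v(1) D(2) hG]
      have nn: "0 \<le> sum g F" "0 \<le> sum h G" using g h by (auto intro: sum_nonneg sliding_weight_nonneg)
      have "sum g F * sum h G \<le> sum g (star N {1..t}) * sum h (star N {1..t})"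
        using Fle(1) Gle(1) nn by (intro mult_mono) auto
      moreover have "sum g F * sum h G < sum g (star N {1..t}) * sum h (star N {1..t})" if "real t < v"
        using Fle(2)[OF _ that tpos(1,3)] Gle(2)[OF _ that tpos(2,3)] nn by (intro mult_strict_mono) auto
      ultimately show ?thesis by (auto simp: star_bound_def)
    qed
  qed
qed

section \<open>Maximal pairs of weighted families\<close>

lemma mem_of_star_bound_eq:
  assumes g: "sliding_weight N v g" and h: "sliding_weight N v h"
    and tpos: "0 < g {1..t}" "0 < h {1..t}" "t \<le> N"
    and sub: "F \<subseteq> star N {1..t}" "G \<subseteq> star N {1..t}"
    and eq: "sum g F * sum h G = sum g (star N {1..t}) * sum h (star N {1..t})"
  shows "{1..t} \<in> F"
proof (rule ccontr)
  assume "{1..t} \<notin> F"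
  then have "sum g F \<le> sum g (star N {1..t} - {{1..t}})"
    using sub by (intro sum_mono2 sliding_weight_nonneg[OF g]) (auto intro: finite_star)
  also have "\<dots> < sum g (star N {1..t})"
    using tpos by (subst sum_diff1) (auto simp: finite_star star_def)
  finally have "sum g F < sum g (star N {1..t})" .
  moreover have "sum h G \<le> sum h (star N {1..t})"
    using sub by (intro sum_mono2 finite_star sliding_weight_nonneg[OF h]) auto
  moreover have "0 \<le> sum g F" by (intro sum_nonneg sliding_weight_nonneg[OF g])
  ultimately have "sum g F * sum h G < sum g (star N {1..t}) * sum h (star N {1..t})"
    using star_pos[OF h tpos(2,3)]
    by (meson le_less_trans mult_left_mono mult_strict_right_mono)
  then show False using eq by simp
qed

text \<open>
  The existence of \<open>t\<close>-sets in both families is what survives undoing the slides, since sliding does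
  not change the size of a set. Members of weight 0 are excluded because they cannot be controlled by
  comparing weights.
\<close>

lemma maximal_pair_bound:
  assumes g: "sliding_weight N v g" and h: "sliding_weight N v h"
    and v: "real t \<le> v" "real t + 4 < 2 * v"
    and tpos: "0 < g {1..t}" "0 < h {1..t}" "t \<le> N"
    and mx: "maximal_pair N t g h F G" and pos: "\<forall>A\<in>F. 0 < g A" "\<forall>B\<in>G. 0 < h B"
  defines "M \<equiv> sum g (star N {1..t}) * sum h (star N {1..t})"
  shows "sum g F * sum h G \<le> M \<and> (real t < v \<longrightarrow> sum g F * sum h G = M \<longrightarrow>
     (\<exists>A\<in>F. card A = t) \<and> (\<exists>B\<in>G. card B = t))"
proof -
  define I where "I F G \<longleftrightarrow> maximal_pair N t g h F G \<and> (\<forall>A\<in>F. 0 < g A) \<and> (\<forall>B\<in>G. 0 < h B)" for F G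
  define R where "R p q \<longleftrightarrow> 1 \<le> p \<and> p < q \<and> q \<le> N" for p q
  have fin: "finite F" "A \<in> F \<Longrightarrow> finite A" if "F \<subseteq> Pow {1..N}" for F and A :: "nat set"
    using that finite_subset[of F "Pow {1..N}"] finite_subset[of A "{1..N}"] by blast+
  have slide_mono: "sum f F \<le> sum f (slide_family p q F)"
    "F \<subseteq> Pow {1..N} \<Longrightarrow> slide_family p q F \<subseteq> Pow {1..N}"
    "(\<forall>A\<in>F. 0 < f A) \<Longrightarrow> (\<forall>A\<in>slide_family p q F. 0 < f A)"
    if "sliding_weight N v f" "R p q" "F \<subseteq> Pow {1..N}" for f F p q
  proof -
    have step: "f A \<le> f (insert p (A - {q}))" if "A \<in> F" "q \<in> A" "p \<notin> A" for A
      using that \<open>R p q\<close> \<open>F \<subseteq> _\<close> by (intro sliding_weight_slide[OF \<open>sliding_weight N v f\<close>]) (auto simp: R_def)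
    then show "sum f F \<le> sum f (slide_family p q F)" by (rule sum_slide_family)
    show "slide_family p q F \<subseteq> Pow {1..N}"
      using that by (fastforce simp: R_def elim!: slide_family_cases)
    assume "\<forall>A\<in>F. 0 < f A"
    then show "\<forall>A\<in>slide_family p q F. 0 < f A"
      using step by (force elim!: slide_family_cases intro: less_le_trans)
  qed
  have nn: "0 \<le> sum g F" "0 \<le> sum h F" for F
    using g h by (auto intro: sum_nonneg sliding_weight_nonneg)
  have mono: "sum g F * sum h G \<le> sum g (slide_family p q F) * sum h (slide_family p q G)"
    if "R p q" "I F G" for p q F G
    using that slide_mono(1)[OF g] slide_mono(1)[OF h] nn
    by (intro mult_mono) (auto simp: I_def maximal_pair_def)
  have "I F G" using mx pos by (simp add: I_def)
  then show ?thesis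
  proof (induction F G rule: slide_induct[where I = I and R = R and w = "\<lambda>x. x"])
    case (weight p q)
    then show ?case by (simp add: R_def)
  next
    case (finite F G)
    then have "F \<subseteq> Pow {1..N}" "G \<subseteq> Pow {1..N}" by (simp_all add: I_def maximal_pair_def)
    then show ?case using fin by blast
  next
    case (closed F G)
    then have "slide_closed N F" "slide_closed N G" by (auto simp: slide_closed_def R_def)
    then have sb: "star_bound N t v g h F G"
      using closed(1) by (intro star_bound_closed[OF g h v tpos]) (auto simp: I_def)
    have "(\<exists>A\<in>F. card A = t) \<and> (\<exists>B\<in>G. card B = t)" if "real t < v" "sum g F * sum h G = M"
    proof -
      have s: "F \<subseteq> star N {1..t}" "G \<subseteq> star N {1..t}" using sb that by (auto simp: star_bound_def M_def)
      have "{1..t} \<in> F" using mem_of_star_bound_eq[OF g h tpos s] that(2) by (simp add: M_def)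
      moreover have "{1..t} \<in> G"
        using mem_of_star_bound_eq[OF h g tpos(2,1,3) s(2,1)] that(2) by (simp add: M_def mult.commute)
      ultimately show ?thesis by force
    qed
    then show ?case using sb by (auto simp: star_bound_def M_def)
  next
    case (inv p q F G)
    then have mx: "maximal_pair N t g h F G" by (simp add: I_def)
    note D = maximal_pairD[OF mx]
    have "cross t (slide_family p q F) (slide_family p q G)"
      by (rule cross_slide_family[OF D(3)]) (use fin(2)[OF D(1)] fin(2)[OF D(2)] in blast)+
    moreover have "sum g F' * sum h G' \<le> sum g (slide_family p q F) * sum h (slide_family p q G)"
      if "F' \<subseteq> Pow {1..N}" "G' \<subseteq> Pow {1..N}" "cross t F' G'" for F' G'
      using D(4)[OF that] mono[OF inv] by linarith
    ultimately show ?case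
      using inv(2) slide_mono(2,3)[OF g inv(1) D(1)] slide_mono(2,3)[OF h inv(1) D(2)] D(1,2)
      unfolding I_def maximal_pair_def by blast
  next
    case (step p q F G)
    have "\<exists>A\<in>F. card A = t" if ex: "\<exists>A\<in>slide_family p q F. card A = t" and sub: "F \<subseteq> Pow {1..N}" for F
    proof -
      obtain A where A: "A \<in> slide_family p q F" "card A = t" using ex by blast
      from A(1) show ?thesis
      proof (cases rule: slide_family_cases)
        case (2 A0)
        then have "card A0 = t"
          using A(2) card_slide[OF fin(2)[OF sub 2(1)], of p q] by (simp add: slide_def)
        then show ?thesis using 2(1) by blast
      qed (use A(2) in blast)
    qed
    moreover have "F \<subseteq> Pow {1..N}" "G \<subseteq> Pow {1..N}" using step(2) by (auto simp: I_def maximal_pair_def)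
    ultimately show ?case using step(3) mono[OF step(1,2)] by (smt (verit))
  qed
qed

theorem weighted_cross_intersection:
  assumes g: "sliding_weight N v g" and h: "sliding_weight N v h"
    and v: "real t \<le> v" "real t + 4 < 2 * v"
    and tpos: "0 < g {1..t}" "0 < h {1..t}" "t \<le> N"
    and sub: "F \<subseteq> Pow {1..N}" "G \<subseteq> Pow {1..N}" and cr: "cross t F G"
  shows "sum g F * sum h G \<le> sum g (star N {1..t}) * sum h (star N {1..t})" (is "_ \<le> ?M")
    and "real t < v \<Longrightarrow> \<forall>A\<in>F. 0 < g A \<Longrightarrow> \<forall>B\<in>G. 0 < h B
      \<Longrightarrow> sum g F * sum h G = sum g (star N {1..t}) * sum h (star N {1..t})
      \<Longrightarrow> (\<exists>A\<in>F. card A = t) \<and> (\<exists>B\<in>G. card B = t)"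
proof -
  let ?P = "{(F, G). F \<subseteq> Pow {1..N} \<and> G \<subseteq> Pow {1..N} \<and> cross t F G}"
  let ?f = "\<lambda>(F, G). sum g F * sum h G"
  have finP: "finite ?P"
    by (rule finite_subset[of _ "Pow (Pow {1..N}) \<times> Pow (Pow {1..N})"]) auto
  have bound: "?f (F, G) \<le> ?M" if "(F, G) \<in> ?P" for F G
  proof -
    have "Max (?f ` ?P) \<in> ?f ` ?P" using finP that by (intro Max_in) auto
    then obtain F1 G1 where F1: "(F1, G1) \<in> ?P" "?f (F1, G1) = Max (?f ` ?P)" by force
    define F2 where "F2 = {A \<in> F1. 0 < g A}"
    define G2 where "G2 = {B \<in> G1. 0 < h B}"
    have fin1: "finite F1" "finite G1" using F1(1) by (auto intro: finite_subset)
    have eq: "sum g F2 = sum g F1" "sum h G2 = sum h G1"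
      unfolding F2_def G2_def using fin1 sliding_weight_nonneg[OF g] sliding_weight_nonneg[OF h]
      by (auto intro!: sum.mono_neutral_left simp: less_le)
    have "maximal_pair N t g h F2 G2"
      unfolding maximal_pair_def eq
    proof (intro conjI allI impI)
      show "F2 \<subseteq> Pow {1..N}" "G2 \<subseteq> Pow {1..N}" "cross t F2 G2"
        using F1(1) by (auto simp: F2_def G2_def cross_def)
      fix F' G' assume "F' \<subseteq> Pow {1..N}" "G' \<subseteq> Pow {1..N}" "cross t F' G'"
      then have "?f (F', G') \<le> Max (?f ` ?P)" using finP by (intro Max_ge) auto
      then show "sum g F' * sum h G' \<le> sum g F1 * sum h G1" using F1(2) by simp
    qed
    from maximal_pair_bound[OF g h v tpos this]
    have "sum g F2 * sum h G2 \<le> ?M" by (simp add: F2_def G2_def)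
    then have "?f (F1, G1) \<le> ?M" by (simp add: eq)
    moreover have "?f (F, G) \<le> ?f (F1, G1)" unfolding F1(2) using finP that by (intro Max_ge) auto
    ultimately show ?thesis by linarith
  qed
  show "sum g F * sum h G \<le> ?M" using bound[of F G] sub cr by auto
  assume *: "real t < v" "\<forall>A\<in>F. 0 < g A" "\<forall>B\<in>G. 0 < h B" "sum g F * sum h G = ?M"
  have "maximal_pair N t g h F G" using sub cr bound *(4) by (auto simp: maximal_pair_def)
  from maximal_pair_bound[OF g h v tpos this *(2,3)] * show "(\<exists>A\<in>F. card A = t) \<and> (\<exists>B\<in>G. card B = t)"
    by blast
qed

section \<open>Labelled sets and their positions labelled 1\<close>

lemma mem_labelled_sets_iff:
  "A \<in> labelled_sets c r \<longleftrightarrow>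
     A \<subseteq> (SIGMA x:{1..length c}. {1..entry c x}) \<and> inj_on fst A \<and> card A = r"
proof
  assume "A \<in> labelled_sets c r"
  then obtain X y where A: "A = (\<lambda>x. (x, y x)) ` X" "X \<in> nsets {1..length c} r"
    "\<forall>x\<in>X. y x \<in> {1..entry c x}" unfolding labelled_sets_def by blast
  then show "A \<subseteq> (SIGMA x:{1..length c}. {1..entry c x}) \<and> inj_on fst A \<and> card A = r"
    by (auto simp: nsets_def card_image inj_on_def)
next
  assume A: "A \<subseteq> (SIGMA x:{1..length c}. {1..entry c x}) \<and> inj_on fst A \<and> card A = r"
  define y where "y = (\<lambda>x. SOME b. (x, b) \<in> A)"
  have y: "(x, y x) \<in> A" if "x \<in> fst ` A" for x
    unfolding y_def by (rule someI_ex) (use that in auto)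
  have "A = (\<lambda>x. (x, y x)) ` (fst ` A)"
  proof
    show "A \<subseteq> (\<lambda>x. (x, y x)) ` (fst ` A)"
    proof
      fix z assume z: "z \<in> A"
      then have "(fst z, y (fst z)) = z"
        using y[of "fst z"] A inj_onD[of fst A "(fst z, y (fst z))" z] by simp
      then show "z \<in> (\<lambda>x. (x, y x)) ` (fst ` A)" using z by (metis image_eqI)
    qed
  qed (use y in auto)
  moreover have "fst ` A \<in> nsets {1..length c} r"
    using A card_image[of fst A] finite_subset[of A "SIGMA x:{1..length c}. {1..entry c x}"]
    by (auto simp: nsets_def)
  moreover have "\<forall>x\<in>fst ` A. y x \<in> {1..entry c x}" using y A by blast
  ultimately show "A \<in> labelled_sets c r" unfolding labelled_sets_def by blast
qed

lemma labelled_setsD: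
  assumes "A \<in> labelled_sets c r"
  shows "(x, y) \<in> A \<Longrightarrow> 1 \<le> x \<and> x \<le> length c \<and> 1 \<le> y \<and> y \<le> entry c x"
    and "(x, y) \<in> A \<Longrightarrow> (x, y') \<in> A \<Longrightarrow> y = y'"
    and "card A = r"
    and "finite A"
proof -
  have A: "A \<subseteq> (SIGMA x:{1..length c}. {1..entry c x})" "inj_on fst A" "card A = r"
    using assms by (simp_all add: mem_labelled_sets_iff)
  show "card A = r" by (fact A(3))
  show "finite A" by (rule finite_subset[OF A(1)]) auto
  show "1 \<le> x \<and> x \<le> length c \<and> 1 \<le> y \<and> y \<le> entry c x" if "(x, y) \<in> A"
    using A(1) that by auto
  show "y = y'" if "(x, y) \<in> A" "(x, y') \<in> A"
    using inj_onD[OF A(2) _ that] by simp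
qed

lemma finite_labelled_sets: "finite (labelled_sets c r)"
proof (rule finite_subset)
  show "labelled_sets c r \<subseteq> Pow (SIGMA x:{1..length c}. {1..entry c x})"
    using mem_labelled_sets_iff by blast
qed auto

lemma labelled_sets_relabel:
  assumes A: "A \<in> labelled_sets c r" and xy: "(x, y) \<in> A" and z: "1 \<le> z" "z \<le> entry c x"
  shows "insert (x, z) (A - {(x, y)}) \<in> labelled_sets c r"
  unfolding mem_labelled_sets_iff
proof (intro conjI)
  note D = labelled_setsD[OF A]
  show "insert (x, z) (A - {(x, y)}) \<subseteq> (SIGMA x:{1..length c}. {1..entry c x})"
    using D(1) xy z by (auto dest: D(1))
  have fresh: "(x, b) \<notin> A - {(x, y)}" for b using D(2)[OF xy] by auto
  have "inj_on fst (A - {(x, y)})" using A by (auto simp: mem_labelled_sets_iff intro: inj_on_diff)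
  moreover have "x \<notin> fst ` (A - {(x, y)})" using fresh by force
  ultimately show "inj_on fst (insert (x, z) (A - {(x, y)}))" by auto
  have "card (insert (x, z) (A - {(x, y)})) = Suc (card (A - {(x, y)}))"
    using D(4) fresh by (subst card_insert_disjoint) auto
  also have "\<dots> = card A" using D(4) xy by (rule card_Suc_Diff1)
  finally show "card (insert (x, z) (A - {(x, y)})) = r" using D(3) by simp
qed

definition ones :: "(nat \<times> nat) set \<Rightarrow> nat set" where
  "ones A = {x. (x, 1) \<in> A}"

definition ones_weight :: "nat list \<Rightarrow> nat \<Rightarrow> nat set \<Rightarrow> real" where
  "ones_weight c r X = real (card {A \<in> labelled_sets c r. ones A = X})"

lemma sum_ones_weight:
  assumes "finite F"
  shows "sum (ones_weight c r) F = real (card {A \<in> labelled_sets c r. ones A \<in> F})"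
proof -
  have "card {A \<in> labelled_sets c r. ones A \<in> F} = card (\<Union>X\<in>F. {A \<in> labelled_sets c r. ones A = X})"
    by (rule arg_cong[where f = card]) auto
  also have "\<dots> = (\<Sum>X\<in>F. card {A \<in> labelled_sets c r. ones A = X})"
    using assms finite_labelled_sets by (intro card_UN_disjoint) auto
  finally show ?thesis by (simp add: ones_weight_def)
qed

lemma entry_mono:
  assumes "IP_seq c" "1 \<le> p" "p \<le> q" "q \<le> length c"
  shows "entry c p \<le> entry c q"
  using assms by (auto simp: entry_def IP_seq_def intro!: sorted_nth_mono)

text \<open>
  Deletion: the label 1 at \<open>x\<close> can be replaced by each of the \<open>entry c x - 1\<close> other labels, and the
  original set can be recovered from the result. Sliding: exchange the positions \<open>p\<close> and \<open>q\<close>, which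
  moves the label 1 from \<open>q\<close> to \<open>p\<close> and any label of \<open>p\<close> to \<open>q\<close>; that label is admissible at \<open>q\<close>
  because the sequence is non-decreasing.
\<close>

lemma sliding_weight_ones_weight:
  assumes c: "IP_seq c" and v: "\<And>x. x \<in> {1..length c} \<Longrightarrow> v + 1 \<le> real (entry c x)"
  shows "sliding_weight N v (ones_weight c r)"
  unfolding sliding_weight_def
proof (intro conjI allI impI)
  fix X show "0 \<le> ones_weight c r X" by (simp add: ones_weight_def)
next
  fix X :: "nat set" and x assume x: "x \<in> X"
  let ?S = "\<lambda>X. {A \<in> labelled_sets c r. ones A = X}"
  have x1: "(x, 1) \<in> A" if "A \<in> ?S X" for A using that x by (auto simp: ones_def)
  show "v * ones_weight c r X \<le> ones_weight c r (X - {x})"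
  proof (cases "?S X = {}")
    case True
    then have "ones_weight c r X = 0" unfolding ones_weight_def True by simp
    then show ?thesis by (simp add: ones_weight_def)
  next
    case False
    then have "x \<in> {1..length c}" using x1 labelled_setsD(1) by fastforce
    then have v: "v \<le> real (card {2..entry c x})" using v[of x] by simp
    define f where "f = (\<lambda>(A, y). insert (x, y :: nat) (A - {(x, 1)}))"
    have inj: "inj_on f (?S X \<times> {2..entry c x})"
    proof (rule inj_onI)
      fix P Q assume P: "P \<in> ?S X \<times> {2..entry c x}" and Q: "Q \<in> ?S X \<times> {2..entry c x}" and eq: "f P = f Q"
      obtain A y B z where AB: "P = (A, y)" "Q = (B, z)" by (cases P; cases Q)
      have A: "A \<in> labelled_sets c r" "(x, 1) \<in> A" and B: "B \<in> labelled_sets c r" "(x, 1) \<in> B"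
        using P Q AB x1 by auto
      have fresh: "(x, b) \<notin> A - {(x, 1)}" "(x, b) \<notin> B - {(x, 1)}" for b
        using labelled_setsD(2)[OF A(1) A(2)] labelled_setsD(2)[OF B(1) B(2)] by auto
      have eq': "insert (x, y) (A - {(x, 1)}) = insert (x, z) (B - {(x, 1)})" using eq AB by (simp add: f_def)
      then have "y = z" using fresh by blast
      then have "A - {(x, 1)} = B - {(x, 1)}" using eq' fresh by (metis insert_ident)
      then have "A = B" using A(2) B(2) by (metis insert_Diff)
      then show "P = Q" using AB \<open>y = z\<close> by simp
    qed
    have "f ` (?S X \<times> {2..entry c x}) \<subseteq> ?S (X - {x})"
    proof
      fix B assume "B \<in> f ` (?S X \<times> {2..entry c x})"
      then obtain A y where A: "A \<in> ?S X" "2 \<le> y" "y \<le> entry c x" "B = insert (x, y) (A - {(x, 1)})"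
        by (auto simp: f_def)
      then have "B \<in> labelled_sets c r" using labelled_sets_relabel[of A c r x 1 y] x1[OF A(1)] by auto
      moreover have "ones B = X - {x}" using A by (auto simp: ones_def)
      ultimately show "B \<in> ?S (X - {x})" by simp
    qed
    then have "card (?S X \<times> {2..entry c x}) \<le> card (?S (X - {x}))"
      using inj finite_labelled_sets by (intro card_inj_on_le) auto
    then have "real (card {2..entry c x}) * real (card (?S X)) \<le> real (card (?S (X - {x})))"
      unfolding card_cartesian_product of_nat_mult[symmetric] of_nat_le_iff by (simp add: mult.commute)
    moreover have "v * real (card (?S X)) \<le> real (card {2..entry c x}) * real (card (?S X))"
      using v by (intro mult_right_mono) auto
    ultimately show ?thesis by (simp add: ones_weight_def)
  qed
next
  fix X :: "nat set" and p q assume p: "1 \<le> p" and pq: "p < q" and q: "q \<in> X" and pX: "p \<notin> X"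
  let ?S = "\<lambda>X. {A \<in> labelled_sets c r. ones A = X}"
  define s where "s = (\<lambda>x. if x = p then q else if x = q then p else x)"
  have ss: "s (s x) = x" for x by (auto simp: s_def)
  define f where "f = (\<lambda>z :: nat \<times> nat. (s (fst z), snd z))"
  have ff: "f (f z) = z" for z by (simp add: f_def ss)
  have injf: "inj f" by (metis ff injI)
  have "(`) f ` ?S X \<subseteq> ?S (insert p (X - {q}))"
  proof
    fix B assume "B \<in> (`) f ` ?S X"
    then obtain A where A: "A \<in> labelled_sets c r" "ones A = X" "B = f ` A" by auto
    note D = labelled_setsD[OF A(1)]
    have q1: "(q, 1) \<in> A" using A(2) q by (auto simp: ones_def)
    have ql: "q \<le> length c" using D(1)[OF q1] by simp
    have qy: "y = 1" if "(q, y) \<in> A" for y using D(2)[OF that q1] .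
    have c_pq: "entry c p \<le> entry c q" using c p pq ql by (intro entry_mono) auto
    have c_p: "1 \<le> entry c p" using c p pq ql by (auto simp: IP_seq_def entry_def Suc_le_eq)
    have "B \<in> labelled_sets c r"
      unfolding mem_labelled_sets_iff
    proof (intro conjI)
      show "B \<subseteq> (SIGMA x:{1..length c}. {1..entry c x})"
      proof
        fix z assume "z \<in> B"
        then obtain x y where xy: "(x, y) \<in> A" "z = (s x, y)" using A(3) by (auto simp: f_def)
        show "z \<in> (SIGMA x:{1..length c}. {1..entry c x})"
          using D(1)[OF xy(1)] xy qy[of y] p pq ql c_pq c_p by (auto simp: s_def)
      qed
      have "inj_on fst A" using A(1) by (simp add: mem_labelled_sets_iff)
      then show "inj_on fst B" unfolding A(3) by (auto simp: inj_on_def f_def) (metis ss fst_conv snd_conv)+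
      show "card B = r" unfolding A(3) using D(3) injf by (simp add: card_image inj_on_subset)
    qed
    moreover have "ones B = insert p (X - {q})"
    proof (rule set_eqI)
      fix x
      have "(x, 1) \<in> B \<longleftrightarrow> f (x, 1) \<in> A" unfolding A(3) by (metis ff image_iff)
      then have "x \<in> ones B \<longleftrightarrow> s x \<in> X" unfolding A(2)[symmetric] by (simp add: ones_def f_def)
      then show "x \<in> ones B \<longleftrightarrow> x \<in> insert p (X - {q})" using q pX pq by (simp add: s_def)
    qed
    ultimately show "B \<in> ?S (insert p (X - {q}))" by simp
  qed
  moreover have "inj_on ((`) f) (?S X)" by (rule inj_onI) (simp only: inj_image_eq_iff[OF injf])
  moreover have "finite (?S (insert p (X - {q})))" using finite_labelled_sets by simp
  ultimately have "card (?S X) \<le> card (?S (insert p (X - {q})))" by (intro card_inj_on_le)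
  then show "ones_weight c r X \<le> ones_weight c r (insert p (X - {q}))" by (simp add: ones_weight_def)
qed

lemma sum_star_ones_weight:
  assumes "length c \<le> N"
  shows "sum (ones_weight c r) (star N {1..t}) = real (card (labelled_sets_fixing c r t))"
proof -
  have "{A \<in> labelled_sets c r. ones A \<in> star N {1..t}} = labelled_sets_fixing c r t"
  proof -
    have "x \<in> {1..N}" if "A \<in> labelled_sets c r" "x \<in> ones A" for A x
      using labelled_setsD(1)[OF that(1), of x 1] that(2) assms by (simp add: ones_def)
    then have "ones A \<subseteq> {1..N}" if "A \<in> labelled_sets c r" for A using that by blast
    then show ?thesis by (auto simp: labelled_sets_fixing_def star_def ones_def)
  qed
  then show ?thesis by (simp add: sum_ones_weight finite_star)
qed

lemma ones_weight_pos:
  assumes "A \<in> labelled_sets c r"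
  shows "0 < ones_weight c r (ones A)"
  using assms finite_labelled_sets by (auto simp: ones_weight_def card_gt_0_iff)

lemma exists_ones_eq:
  assumes r: "t \<le> r" "r \<le> length c" and c: "\<And>x. x \<in> {1..length c} \<Longrightarrow> 2 \<le> entry c x"
  shows "\<exists>A\<in>labelled_sets c r. ones A = {1..t}"
proof -
  define y where "y = (\<lambda>x. if x \<le> t then 1 else 2 :: nat)"
  have "(\<lambda>x. (x, y x)) ` {1..r} \<in> labelled_sets c r"
    unfolding labelled_sets_def
  proof (intro CollectI exI conjI)
    show "{1..r} \<in> nsets {1..length c} r" using r by (auto simp: nsets_def)
    show "\<forall>x\<in>{1..r}. y x \<in> {1..entry c x}" using c r by (fastforce simp: y_def)
  qed simp
  moreover have "ones ((\<lambda>x. (x, y x)) ` {1..r}) = {1..t}"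
  proof (rule set_eqI)
    fix x
    have "x \<in> ones ((\<lambda>x. (x, y x)) ` {1..r}) \<longleftrightarrow> x \<in> {1..r} \<and> y x = 1" by (auto simp: ones_def)
    then show "x \<in> ones ((\<lambda>x. (x, y x)) ` {1..r}) \<longleftrightarrow> x \<in> {1..t}" using r by (simp add: y_def)
  qed
  ultimately show ?thesis by blast
qed

section \<open>Two families of labelled sets\<close>

definition good_entries :: "real \<Rightarrow> nat list \<Rightarrow> bool" where
  "good_entries v c \<longleftrightarrow> IP_seq c \<and> (\<forall>x\<in>{1..length c}. v + 1 \<le> real (entry c x))"

text \<open>
  The slides used for labelled sets: replace some label greater than 1 by the label 1.
\<close>

definition label_one :: "nat \<times> nat \<Rightarrow> nat \<times> nat \<Rightarrow> bool" where
  "label_one p q \<longleftrightarrow> p = (fst q, 1) \<and> 1 < snd q"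

lemma slide_labelled_sets:
  assumes "A \<in> labelled_sets c r" "label_one p q"
  shows "slide p q A \<in> labelled_sets c r"
proof (cases "q \<in> A \<and> p \<notin> A")
  case True
  obtain x y where q: "q = (x, y)" "p = (x, 1)" using assms(2) by (cases q) (auto simp: label_one_def)
  have "1 \<le> entry c x" using labelled_setsD(1)[OF assms(1), of x y] True q by auto
  then show ?thesis
    using labelled_sets_relabel[OF assms(1), of x y 1] True q by (simp add: slide_def)
qed (use assms in \<open>auto simp: slide_def\<close>)

lemma slide_family_labelled_sets:
  assumes "\<A> \<subseteq> labelled_sets c r" "label_one p q"
  shows "slide_family p q \<A> \<subseteq> labelled_sets c r"
proof
  fix A assume "A \<in> slide_family p q \<A>"
  then obtain B where "B \<in> \<A>" "A = B \<or> A = slide p q B"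
    by (auto simp: slide_family_def slide_member_def)
  then show "A \<in> labelled_sets c r" using assms slide_labelled_sets by blast
qed

text \<open>
  If \<open>A\<close> and \<open>B\<close> agree at a position with a label greater than 1, relabelling that position of \<open>A\<close> by
  1 gives a member of \<open>\<A>\<close> that agrees with \<open>B\<close> in fewer such positions and in the same positions
  labelled 1, as \<open>B\<close> has another label there. When no such position is left, the intersection
  consists of pairs labelled 1.
\<close>

lemma cross_ones:
  assumes sub: "\<A> \<subseteq> labelled_sets c r" "\<B> \<subseteq> labelled_sets d s"
    and cr: "cross t \<A> \<B>"
    and cl: "\<And>p q A. label_one p q \<Longrightarrow> A \<in> \<A> \<Longrightarrow> slide p q A \<in> \<A>"
  shows "cross t (ones ` \<A>) (ones ` \<B>)"
proof -
  have "t \<le> card (ones A \<inter> ones B)" if "A \<in> \<A>" "B \<in> \<B>" for A B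
    using that
  proof (induction "card {z \<in> A \<inter> B. 1 < snd z}" arbitrary: A rule: less_induct)
    case less
    note DA = labelled_setsD[OF subsetD[OF sub(1) less.prems(1)]]
    note DB = labelled_setsD[OF subsetD[OF sub(2) less.prems(2)]]
    show ?case
    proof (cases "\<exists>z \<in> A \<inter> B. 1 < snd z")
      case False
      have "A \<inter> B = (\<lambda>x. (x, 1)) ` (ones A \<inter> ones B)"
      proof (intro equalityI subsetI)
        fix z assume z: "z \<in> A \<inter> B"
        then have "snd z = 1" using False DA(1)[of "fst z" "snd z"] by force
        then show "z \<in> (\<lambda>x. (x, 1)) ` (ones A \<inter> ones B)"
          using z by (cases z) (auto simp: ones_def)
      qed (auto simp: ones_def)
      then have "card (A \<inter> B) = card (ones A \<inter> ones B)"
        by (simp add: card_image inj_on_def)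
      moreover have "t \<le> card (A \<inter> B)" using cr less.prems unfolding cross_def by blast
      ultimately show ?thesis by simp
    next
      case True
      then obtain x y where xy: "(x, y) \<in> A" "(x, y) \<in> B" "1 < y" by auto
      have 1: "(x, 1) \<notin> A" "(x, 1) \<notin> B" using DA(2)[OF xy(1)] DB(2)[OF xy(2)] xy(3) by auto
      define A' where "A' = insert (x, 1) (A - {(x, y)})"
      have "slide (x, 1) (x, y) A = A'" using xy 1 by (simp add: slide_def A'_def)
      then have A': "A' \<in> \<A>"
        using cl[of "(x, 1)" "(x, y)" A] less.prems xy(3) by (simp add: label_one_def)
      have "card {z \<in> A' \<inter> B. 1 < snd z} < card {z \<in> A \<inter> B. 1 < snd z}"
      proof (rule psubset_card_mono)
        show "finite {z \<in> A \<inter> B. 1 < snd z}" using DA(4) by simp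
        have "(x, y) \<notin> A'" using xy(3) by (simp add: A'_def)
        then have "(x, y) \<in> {z \<in> A \<inter> B. 1 < snd z} - {z \<in> A' \<inter> B. 1 < snd z}" using xy by simp
        moreover have "{z \<in> A' \<inter> B. 1 < snd z} \<subseteq> {z \<in> A \<inter> B. 1 < snd z}" by (auto simp: A'_def)
        ultimately show "{z \<in> A' \<inter> B. 1 < snd z} \<subset> {z \<in> A \<inter> B. 1 < snd z}" by blast
      qed
      from less.hyps[OF this A' less.prems(2)] have "t \<le> card (ones A' \<inter> ones B)" .
      also have "ones A' \<inter> ones B = ones A \<inter> ones B"
        using 1 xy(3) by (auto simp: A'_def ones_def)
      finally show ?thesis .
    qed
  qed
  then show ?thesis by (auto simp: cross_def)
qed

lemma labelled_slide_induct [consumes 3, case_names closed step]: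
  assumes sub: "\<A> \<subseteq> labelled_sets c r" "\<B> \<subseteq> labelled_sets d s" and cr: "cross t \<A> \<B>"
    and closed: "\<And>\<A> \<B>. \<A> \<subseteq> labelled_sets c r \<Longrightarrow> \<B> \<subseteq> labelled_sets d s \<Longrightarrow> cross t \<A> \<B>
      \<Longrightarrow> cross t (ones ` \<A>) (ones ` \<B>) \<Longrightarrow> P \<A> \<B>"
    and step: "\<And>p q \<A> \<B>. label_one p q \<Longrightarrow> \<A> \<subseteq> labelled_sets c r \<Longrightarrow> \<B> \<subseteq> labelled_sets d s \<Longrightarrow> cross t \<A> \<B>
      \<Longrightarrow> slide_family p q \<A> \<subseteq> labelled_sets c r \<Longrightarrow> slide_family p q \<B> \<subseteq> labelled_sets d s
      \<Longrightarrow> cross t (slide_family p q \<A>) (slide_family p q \<B>)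
      \<Longrightarrow> P (slide_family p q \<A>) (slide_family p q \<B>) \<Longrightarrow> P \<A> \<B>"
  shows "P \<A> \<B>"
proof -
  define I where "I \<A> \<B> \<longleftrightarrow> \<A> \<subseteq> labelled_sets c r \<and> \<B> \<subseteq> labelled_sets d s \<and> cross t \<A> \<B>" for \<A> \<B>
  have fin: "\<forall>A\<in>\<A>. finite A" "finite \<A>" if "\<A> \<subseteq> labelled_sets c r" for \<A> c r
    using that labelled_setsD(4) finite_labelled_sets finite_subset by blast+
  have inv: "I (slide_family p q \<A>) (slide_family p q \<B>)" if "label_one p q" "I \<A> \<B>" for p q \<A> \<B>
    using that slide_family_labelled_sets cross_slide_family[of t \<A> \<B> p q] fin unfolding I_def by blast
  have "I \<A> \<B>" using sub cr by (simp add: I_def)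
  then show ?thesis
  proof (induction \<A> \<B> rule: slide_induct[where I = I and R = label_one and w = snd])
    case (closed \<A> \<B>)
    then have IAB: "\<A> \<subseteq> labelled_sets c r" "\<B> \<subseteq> labelled_sets d s" "cross t \<A> \<B>"
      by (simp_all add: I_def)
    then show ?case by (rule assms(4)) (rule cross_ones[OF IAB closed(2)])
  next
    case (step p q \<A> \<B>)
    have "I \<A> \<B>" "I (slide_family p q \<A>) (slide_family p q \<B>)" using step(1,2) inv by blast+
    note I = this[unfolded I_def]
    show ?case
      by (rule assms(5)[OF step(1) _ _ _ _ _ _ step(3)]) (use I in simp_all)
  next
    case (weight p q)
    then show ?case by (simp add: label_one_def)
  next
    case (finite \<A> \<B>)
    then show ?case using fin[of \<A> c r] fin[of \<B> d s] unfolding I_def by blast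
  next
    case (inv p q \<A> \<B>)
    then show ?case by (rule \<open>\<And>p q \<A> \<B>. label_one p q \<Longrightarrow> I \<A> \<B> \<Longrightarrow> I (slide_family p q \<A>) (slide_family p q \<B>)\<close>)
  qed
qed

lemma card_le_sum_ones_weight:
  assumes "\<A> \<subseteq> labelled_sets c r"
  shows "real (card \<A>) \<le> sum (ones_weight c r) (ones ` \<A>)"
proof -
  have "finite \<A>" using assms finite_labelled_sets finite_subset by blast
  then have "sum (ones_weight c r) (ones ` \<A>) = real (card {A \<in> labelled_sets c r. ones A \<in> ones ` \<A>})"
    by (intro sum_ones_weight) auto
  moreover have "card \<A> \<le> card {A \<in> labelled_sets c r. ones A \<in> ones ` \<A>}"
    using assms finite_labelled_sets by (intro card_mono) auto
  ultimately show ?thesis by simp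
qed

text \<open>
  At each position the two sets \<open>A\<close> and \<open>B\<close> use at most one label each, so a third label is free.
\<close>

lemma exists_avoiding:
  assumes c: "\<And>x. x \<in> {1..length c} \<Longrightarrow> 3 \<le> entry c x"
    and Z0: "Z0 \<in> labelled_sets c r" "T \<subseteq> Z0"
    and A: "\<And>x y y'. (x, y) \<in> A \<Longrightarrow> (x, y') \<in> A \<Longrightarrow> y = y'"
    and B: "\<And>x y y'. (x, y) \<in> B \<Longrightarrow> (x, y') \<in> B \<Longrightarrow> y = y'"
  shows "\<exists>Z\<in>labelled_sets c r. T \<subseteq> Z \<and> Z \<inter> (A \<union> B) \<subseteq> T"
  using Z0
proof (induction "card ((Z0 \<inter> (A \<union> B)) - T)" arbitrary: Z0 rule: less_induct)
  case less
  note D = labelled_setsD[OF less.prems(1)]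
  show ?case
  proof (cases "Z0 \<inter> (A \<union> B) \<subseteq> T")
    case True
    then show ?thesis using less.prems by blast
  next
    case False
    then obtain x y where xy: "(x, y) \<in> Z0" "(x, y) \<in> A \<union> B" "(x, y) \<notin> T" by auto
    have x: "x \<in> {1..length c}" using D(1)[OF xy(1)] by simp
    have "\<exists>z. 1 \<le> z \<and> z \<le> 3 \<and> (x, z) \<notin> A \<and> (x, z) \<notin> B"
    proof (rule ccontr)
      assume "\<not> ?thesis"
      then have "(x, 1) \<in> A \<or> (x, 1) \<in> B" "(x, 2) \<in> A \<or> (x, 2) \<in> B" "(x, 3) \<in> A \<or> (x, 3) \<in> B" by auto
      then show False using A[of x 1 2] A[of x 1 3] A[of x 2 3] B[of x 1 2] B[of x 1 3] B[of x 2 3] by auto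
    qed
    then obtain z where z: "1 \<le> z" "z \<le> 3" "(x, z) \<notin> A \<union> B" by auto
    define Z1 where "Z1 = insert (x, z) (Z0 - {(x, y)})"
    have Z1: "Z1 \<in> labelled_sets c r" "T \<subseteq> Z1"
      using labelled_sets_relabel[OF less.prems(1) xy(1)] z c[OF x] xy(3) less.prems(2)
      by (auto simp: Z1_def)
    have "card (Z1 \<inter> (A \<union> B) - T) < card (Z0 \<inter> (A \<union> B) - T)"
    proof (rule psubset_card_mono)
      show "finite (Z0 \<inter> (A \<union> B) - T)" using D(4) by simp
      show "Z1 \<inter> (A \<union> B) - T \<subset> Z0 \<inter> (A \<union> B) - T" using z(3) xy unfolding Z1_def by auto
    qed
    from less.hyps[OF this Z1] show ?thesis .
  qed
qed

abbreviation "fixing c r T \<equiv> members_containing (labelled_sets c r) T"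

lemma cross_fixing:
  assumes "card T = t"
  shows "cross t (fixing c r T) (fixing d s T)"
  unfolding cross_def
proof (intro ballI)
  fix A B assume "A \<in> fixing c r T" "B \<in> fixing d s T"
  then have "T \<subseteq> A \<inter> B" "finite A" using labelled_setsD(4) by (auto simp: members_containing_def)
  then have "card T \<le> card (A \<inter> B)" by (intro card_mono) auto
  then show "t \<le> card (A \<inter> B)" using assms by simp
qed

text \<open>
  The interesting case is \<open>p \<in> T\<close>. Every member of \<open>\<A>\<close> then contains either \<open>T\<close> or the set \<open>T'\<close>
  obtained from \<open>T\<close> by undoing the slide, and the same choice has to be made throughout both families:
  members with different choices that share only elements of \<open>T - {p}\<close> would violate the
  intersection property, and suitable partners exist by \<open>exists_avoiding\<close>.
\<close>

lemma slide_fixing_trace_back: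
  assumes c: "\<And>x. x \<in> {1..length c} \<Longrightarrow> 3 \<le> entry c x"
    and d: "\<And>x. x \<in> {1..length d} \<Longrightarrow> 3 \<le> entry d x"
    and sub: "\<A> \<subseteq> labelled_sets c r" "\<B> \<subseteq> labelled_sets d s" and cr: "cross t \<A> \<B>"
    and pq: "label_one p q" and T: "card T = t" "1 \<le> t"
    and eq: "slide_family p q \<A> = fixing c r T" "slide_family p q \<B> = fixing d s T"
    and ne: "\<A> \<noteq> {}" "\<B> \<noteq> {}"
  shows "\<exists>T'. card T' = t \<and> \<A> \<subseteq> fixing c r T' \<and> \<B> \<subseteq> fixing d s T'"
proof (cases "p \<in> T")
  case False
  have "\<A> \<subseteq> fixing c r T" if eq: "slide_family p q \<A> = fixing c r T" and sub: "\<A> \<subseteq> labelled_sets c r" for \<A> c r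
  proof
    fix A assume A: "A \<in> \<A>"
    then have "slide_member p q \<A> A \<in> fixing c r T" using eq unfolding slide_family_def by blast
    then have "T \<subseteq> A" using False unfolding members_containing_def slide_member_def slide_def
      by (auto split: if_splits)
    then show "A \<in> fixing c r T" using A sub by (auto simp: members_containing_def)
  qed
  then show ?thesis using eq sub T by blast
next
  case pT: True
  define T' where "T' = insert q (T - {p})"
  have finT: "finite T" using T by (metis card.infinite not_one_le_zero)
  have pq1: "p \<noteq> q" using pq by (cases q) (auto simp: label_one_def)
  have not_both: "\<not> (p \<in> A \<and> q \<in> A)" if "A \<in> labelled_sets c r" for A c r
    using labelled_setsD(2)[OF that, of "fst q" 1 "snd q"] pq by (auto simp: label_one_def)
  have p_or_q: "p \<in> A \<and> T \<subseteq> A \<or> q \<in> A \<and> p \<notin> A \<and> T' \<subseteq> A"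
    if eq: "slide_family p q \<A> = fixing c r T" and A: "A \<in> \<A>" for \<A> c r A
  proof -
    have "slide_member p q \<A> A \<in> fixing c r T" using eq A unfolding slide_family_def by blast
    then show ?thesis using pT unfolding T'_def members_containing_def slide_member_def slide_def
      by (auto split: if_splits)
  qed
  \<comment> \<open>a member of the slid family comes from itself or from its preimage under sliding\<close>
  have origin: "Z \<in> \<A> \<or> insert q (Z - {p}) \<in> \<A> \<and> Z \<notin> \<A>"
    if eq: "slide_family p q \<A> = fixing c r T" and Z: "Z \<in> fixing c r T" for \<A> c r Z
  proof -
    have "Z \<in> slide_family p q \<A>" using eq Z by simp
    then show ?thesis
    proof (cases rule: slide_family_cases)
      case (2 A0)
      then have "insert q (Z - {p}) = A0" by auto
      then show ?thesis using 2 by auto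
    qed auto
  qed
  have small: "card (A \<inter> B) < t" if "A \<inter> B \<subseteq> T - {p}" for A B
  proof -
    have "card (A \<inter> B) \<le> card (T - {p})" using that finT by (intro card_mono) auto
    also have "\<dots> < card T" using finT pT by (intro card_Diff1_less)
    finally show ?thesis using T by simp
  qed
  \<comment> \<open>one family cannot contain members of both kinds, since some partner avoids both of them outside \<open>T\<close>\<close>
  have uniform: "(\<forall>A\<in>\<A>. p \<in> A) \<or> (\<forall>A\<in>\<A>. q \<in> A \<and> p \<notin> A)"
    if eqA: "slide_family p q \<A> = fixing c r T" and eqB: "slide_family p q \<B> = fixing d s T"
      and sub: "\<A> \<subseteq> labelled_sets c r" and d: "\<And>x. x \<in> {1..length d} \<Longrightarrow> 3 \<le> entry d x"
      and cr: "cross t \<A> \<B>" and ne: "\<B> \<noteq> {}" for \<A> \<B> c d r s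
  proof (rule ccontr)
    assume "\<not> ?thesis"
    then obtain A1 A2 where A1: "A1 \<in> \<A>" "p \<in> A1" and A2: "A2 \<in> \<A>" "p \<notin> A2"
      using p_or_q[OF eqA] by blast
    have q1: "q \<notin> A1" using not_both A1 sub by blast
    obtain Z0 where "Z0 \<in> fixing d s T" using eqB ne by (auto simp: slide_family_def)
    then obtain Z where Z: "Z \<in> labelled_sets d s" "T \<subseteq> Z" "Z \<inter> (A1 \<union> A2) \<subseteq> T"
      using exists_avoiding[OF d, of Z0 s T A1 A2] labelled_setsD(2) A1(1) A2(1) sub
      unfolding members_containing_def by blast
    have "Z \<in> fixing d s T" using Z by (simp add: members_containing_def)
    from origin[OF eqB this] show False
    proof (elim disjE conjE)
      assume "Z \<in> \<B>"
      moreover have "card (A2 \<inter> Z) < t" using Z(3) A2(2) by (intro small) auto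
      ultimately show False using cr A2(1) by (force simp: cross_def)
    next
      assume "insert q (Z - {p}) \<in> \<B>"
      moreover have "card (A1 \<inter> insert q (Z - {p})) < t" using Z(3) q1 by (intro small) auto
      ultimately show False using cr A1(1) by (force simp: cross_def)
    qed
  qed
  \<comment> \<open>nor can the two families be of different kinds\<close>
  have opposite: False
    if eqA: "slide_family p q \<A> = fixing c r T" and sub: "\<B> \<subseteq> labelled_sets d s"
      and c: "\<And>x. x \<in> {1..length c} \<Longrightarrow> 3 \<le> entry c x" and ne: "\<A> \<noteq> {}"
      and cr: "cross t \<A> \<B>" and p: "\<forall>A\<in>\<A>. p \<in> A" and B: "B \<in> \<B>" "q \<in> B" "p \<notin> B" for \<A> \<B> c d r s B
  proof -
    obtain Z0 where "Z0 \<in> fixing c r T" using eqA ne by (auto simp: slide_family_def)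
    then obtain Z where Z: "Z \<in> labelled_sets c r" "T \<subseteq> Z" "Z \<inter> (B \<union> B) \<subseteq> T"
      using exists_avoiding[OF c, of Z0 r T B B] labelled_setsD(2) B(1) sub
      unfolding members_containing_def by blast
    have "Z \<in> fixing c r T" using Z by (simp add: members_containing_def)
    then have "Z \<in> \<A>" using origin[OF eqA, of Z] p pq1 by auto
    moreover have "card (Z \<inter> B) < t" using Z(3) B(3) by (intro small) auto
    ultimately show False using cr B(1) by (force simp: cross_def)
  qed
  have all_p: "\<A> \<subseteq> fixing c r T"
    if eq: "slide_family p q \<A> = fixing c r T" and p: "\<forall>A\<in>\<A>. p \<in> A" and sub: "\<A> \<subseteq> labelled_sets c r" for \<A> c r
  proof
    fix A assume A: "A \<in> \<A>"
    then have "A \<in> labelled_sets c r" "T \<subseteq> A" using sub p p_or_q[OF eq A] by auto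
    then show "A \<in> fixing c r T" by (simp add: members_containing_def)
  qed
  have all_q: "\<A> \<subseteq> fixing c r T'"
    if eq: "slide_family p q \<A> = fixing c r T" and q: "\<forall>A\<in>\<A>. q \<in> A \<and> p \<notin> A" and sub: "\<A> \<subseteq> labelled_sets c r" for \<A> c r
  proof
    fix A assume A: "A \<in> \<A>"
    then have "A \<in> labelled_sets c r" "T' \<subseteq> A" using sub q p_or_q[OF eq A] by auto
    then show "A \<in> fixing c r T'" by (simp add: members_containing_def)
  qed
  have cr': "cross t \<B> \<A>" using cr by (simp add: cross_commute)
  note uA = uniform[OF eq sub(1) d cr ne(2)] and uB = uniform[OF eq(2,1) sub(2) c cr' ne(1)]
  show ?thesis
  proof (cases "\<forall>A\<in>\<A>. p \<in> A")
    case True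
    then have pB: "\<forall>B\<in>\<B>. p \<in> B" using opposite[OF eq(1) sub(2) c ne(1) cr True] p_or_q[OF eq(2)] by blast
    show ?thesis using all_p[OF eq(1) True sub(1)] all_p[OF eq(2) pB sub(2)] T(1) by blast
  next
    case False
    then have qA: "\<forall>A\<in>\<A>. q \<in> A \<and> p \<notin> A" using uA by blast
    then have "\<not> (\<forall>B\<in>\<B>. p \<in> B)"
      using opposite[OF eq(2) sub(1) d ne(2) cr'] ne(1) by blast
    then have qB: "\<forall>B\<in>\<B>. q \<in> B \<and> p \<notin> B" using uB by blast
    have "q \<notin> T"
    proof
      assume "q \<in> T"
      obtain Z where "Z \<in> fixing c r T" using eq(1) ne(1) by (auto simp: slide_family_def)
      then show False using not_both[of Z c r] pT \<open>q \<in> T\<close> by (auto simp: members_containing_def)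
    qed
    then have "card T' = t"
      using T finT pT unfolding T'_def by (simp add: card_insert_if card_Diff_singleton)
    moreover have "\<A> \<subseteq> fixing c r T'" "\<B> \<subseteq> fixing d s T'"
      using all_q[OF eq(1) qA sub(1)] all_q[OF eq(2) qB sub(2)] by blast+
    ultimately show ?thesis by blast
  qed
qed

lemma nat_mult_le_imp_eq:
  fixes a b a' b' :: nat
  assumes "a' * b' \<le> a * b" "0 < a" "0 < b" "a \<le> a'" "b \<le> b'"
  shows "a = a' \<and> b = b'"
proof -
  have "a * b' \<le> a * b"
    using assms mult_le_mono1[of a a' b'] by linarith
  then have "b = b'" using assms by simp
  moreover from this have "a' * b \<le> a * b" using assms(1) by simp
  then have "a = a'" using assms by simp
  ultimately show ?thesis by simp
qed

lemma good_entries_ge_3: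
  assumes "good_entries v c" "real t + 4 < 2 * v" "x \<in> {1..length c}"
  shows "3 \<le> entry c x"
proof -
  have "v + 1 \<le> real (entry c x)" using assms by (simp add: good_entries_def)
  then show ?thesis using assms(2) by simp
qed

lemma good_entries_fixing:
  assumes c: "good_entries v c" and v: "real t + 4 < 2 * v" and r: "t \<le> r" "r \<le> length c"
  shows ones_weight_fixing_pos: "0 < ones_weight c r {1..t}"
    and card_labelled_sets_fixing_pos: "0 < card (labelled_sets_fixing c r t)"
proof -
  have "\<And>x. x \<in> {1..length c} \<Longrightarrow> 2 \<le> entry c x" using good_entries_ge_3[OF c v] by force
  then obtain A where A: "A \<in> labelled_sets c r" "ones A = {1..t}" using exists_ones_eq[OF r] by blast
  then show "0 < ones_weight c r {1..t}" using ones_weight_pos[OF A(1)] by simp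
  have "A \<in> labelled_sets_fixing c r t" using A by (auto simp: labelled_sets_fixing_def ones_def)
  moreover have "finite (labelled_sets_fixing c r t)"
    using finite_labelled_sets by (simp add: labelled_sets_fixing_def)
  ultimately show "0 < card (labelled_sets_fixing c r t)" by (auto simp: card_gt_0_iff)
qed

text \<open>
  The bound is the weighted theorem for the sets of positions labelled 1. In case of equality for a
  pair that is closed under relabelling by 1, the weighted theorem provides a \<open>t\<close>-set \<open>X\<close> of such
  positions in \<open>\<A>\<close> and one in \<open>\<B>\<close>. Each is contained in every such set of the other family, so they
  coincide, and \<open>T\<close> consists of the positions of \<open>X\<close> labelled 1.
\<close>

lemma pair_bound:
  assumes c: "good_entries v c" and d: "good_entries v d"
    and v: "real t \<le> v" "real t + 4 < 2 * v"
    and r: "t \<le> r" "r \<le> length c" and s: "t \<le> s" "s \<le> length d"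
    and sub: "\<A> \<subseteq> labelled_sets c r" "\<B> \<subseteq> labelled_sets d s" and cr: "cross t \<A> \<B>"
  defines "M \<equiv> card (labelled_sets_fixing c r t) * card (labelled_sets_fixing d s t)"
  shows "card \<A> * card \<B> \<le> M"
    and "1 \<le> t \<Longrightarrow> real t < v \<Longrightarrow> card \<A> * card \<B> = M \<Longrightarrow>
      \<exists>T. card T = t \<and> \<A> = fixing c r T \<and> \<B> = fixing d s T"
proof -
  define N where "N = max (length c) (length d)"
  have gc: "sliding_weight N v (ones_weight c r)" and gd: "sliding_weight N v (ones_weight d s)"
    using c d by (auto simp: good_entries_def intro: sliding_weight_ones_weight)
  have tpos: "0 < ones_weight c r {1..t}" "0 < ones_weight d s {1..t}" "t \<le> N"
    using ones_weight_fixing_pos[OF c v(2) r] ones_weight_fixing_pos[OF d v(2) s] r by (auto simp: N_def)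
  have M: "0 < M"
    using card_labelled_sets_fixing_pos[OF c v(2) r] card_labelled_sets_fixing_pos[OF d v(2) s] by (simp add: M_def)
  have lenN: "length c \<le> N" "length d \<le> N" by (auto simp: N_def)
  have starM: "sum (ones_weight c r) (star N {1..t}) * sum (ones_weight d s) (star N {1..t}) = real M"
    unfolding M_def sum_star_ones_weight[OF lenN(1)] sum_star_ones_weight[OF lenN(2)] by simp
  have onesN: "ones ` \<A> \<subseteq> Pow {1..N}" if "\<A> \<subseteq> labelled_sets c r" "length c \<le> N" for \<A> c r
  proof -
    have "x \<in> {1..N}" if "A \<in> \<A>" "x \<in> ones A" for A x
    proof -
      have "(x, 1) \<in> A" using that by (simp add: ones_def)
      then show ?thesis
        using labelled_setsD(1)[of A c r x 1] that(1) \<open>\<A> \<subseteq> labelled_sets c r\<close> \<open>length c \<le> N\<close> by auto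
    qed
    then show ?thesis by blast
  qed
  have prod_le: "real (card \<A> * card \<B>)
      \<le> sum (ones_weight c r) (ones ` \<A>) * sum (ones_weight d s) (ones ` \<B>)"
    if "\<A> \<subseteq> labelled_sets c r" "\<B> \<subseteq> labelled_sets d s" for \<A> \<B>
    unfolding of_nat_mult
    by (intro mult_mono card_le_sum_ones_weight that sum_nonneg sliding_weight_nonneg[OF gc]) simp
  have bound: "card \<A> * card \<B> \<le> M"
    if "\<A> \<subseteq> labelled_sets c r" "\<B> \<subseteq> labelled_sets d s" "cross t \<A> \<B>" for \<A> \<B>
    using that
  proof (induction rule: labelled_slide_induct)
    case (closed \<A> \<B>)
    have "real (card \<A> * card \<B>) \<le> real M"
      using prod_le[OF closed(1,2)]
        weighted_cross_intersection(1)[OF gc gd v tpos onesN[OF closed(1) lenN(1)] onesN[OF closed(2) lenN(2)] closed(4)]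
      by (simp only: starM)
    then show ?case by linarith
  next
    case (step p q \<A> \<B>)
    then show ?case by (simp add: card_slide_family)
  qed
  show "card \<A> * card \<B> \<le> M" by (rule bound[OF sub cr])
  \<comment> \<open>a maximal pair fixing the elements of \<open>T\<close> must be all of it, as the full pair is again cross-intersecting\<close>
  have fill: "\<A> = fixing c r T \<and> \<B> = fixing d s T"
    if "card T = t" "\<A> \<subseteq> fixing c r T" "\<B> \<subseteq> fixing d s T" "card \<A> * card \<B> = M" for \<A> \<B> T
  proof -
    have fin: "finite (fixing c r T)" "finite (fixing d s T)"
      using finite_labelled_sets by (auto simp: members_containing_def)
    have le: "card \<A> \<le> card (fixing c r T)" "card \<B> \<le> card (fixing d s T)"
      using that fin by (auto intro: card_mono)
    have "card (fixing c r T) * card (fixing d s T) \<le> card \<A> * card \<B>"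
      unfolding that(4) by (rule bound[OF _ _ cross_fixing[OF that(1)]]) (auto simp: members_containing_def)
    moreover have "0 < card \<A>" "0 < card \<B>" using that(4) M by (auto intro: gr0I)
    ultimately have "card \<A> = card (fixing c r T) \<and> card \<B> = card (fixing d s T)"
      using le by (rule nat_mult_le_imp_eq)
    then show ?thesis using that fin by (metis card_subset_eq)
  qed
  assume t: "1 \<le> t" and vt: "real t < v" and eqM: "card \<A> * card \<B> = M"
  have "\<exists>T. card T = t \<and> \<A> \<subseteq> fixing c r T \<and> \<B> \<subseteq> fixing d s T"
    using sub cr eqM
  proof (induction rule: labelled_slide_induct)
    case (closed \<A> \<B>)
    note wc = weighted_cross_intersection[OF gc gd v tpos onesN[OF closed(1) lenN(1)] onesN[OF closed(2) lenN(2)] closed(4)]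
    have "\<forall>X\<in>ones ` \<A>. 0 < ones_weight c r X" "\<forall>X\<in>ones ` \<B>. 0 < ones_weight d s X"
      using closed ones_weight_pos by blast+
    moreover have "sum (ones_weight c r) (ones ` \<A>) * sum (ones_weight d s) (ones ` \<B>)
        = sum (ones_weight c r) (star N {1..t}) * sum (ones_weight d s) (star N {1..t})"
      using prod_le[OF closed(1,2)] wc(1) closed(5) starM by simp
    ultimately obtain A B where A: "A \<in> \<A>" "card (ones A) = t" and B: "B \<in> \<B>" "card (ones B) = t"
      using wc(2)[OF vt] by blast
    have fin: "finite (ones A)" "finite (ones B)" using A B t by (metis card.infinite not_one_le_zero)+
    have sA: "ones A \<subseteq> ones B'" if "B' \<in> \<B>" for B'
    proof -
      have "t \<le> card (ones A \<inter> ones B')" using closed(4) A that by (auto simp: cross_def)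
      then have "ones A \<inter> ones B' = ones A" using A(2) fin by (intro card_seteq) auto
      then show ?thesis by blast
    qed
    have sB: "ones B \<subseteq> ones A'" if "A' \<in> \<A>" for A'
    proof -
      have "t \<le> card (ones A' \<inter> ones B)" using closed(4) B that by (auto simp: cross_def)
      then have "ones A' \<inter> ones B = ones B" using B(2) fin by (intro card_seteq) auto
      then show ?thesis by blast
    qed
    have eq: "ones A = ones B" using sA[OF B(1)] sB[OF A(1)] by blast
    define T where "T = (\<lambda>x. (x, 1 :: nat)) ` ones A"
    have "card T = t" using A(2) by (simp add: T_def card_image inj_on_def)
    moreover have "T \<subseteq> C \<longleftrightarrow> ones A \<subseteq> ones C" for C by (auto simp: T_def ones_def)
    ultimately show ?case using sA sB eq closed(1,2) unfolding members_containing_def by blast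
  next
    case (step p q \<A> \<B>)
    have *: "card (slide_family p q \<A>) * card (slide_family p q \<B>) = M"
      using step.prems by (simp add: card_slide_family)
    from step.IH[OF *] obtain T where T0: "card T = t"
      "slide_family p q \<A> \<subseteq> fixing c r T" "slide_family p q \<B> \<subseteq> fixing d s T" by blast
    note T = T0(1) fill[OF T0 *, THEN conjunct1] fill[OF T0 *, THEN conjunct2]
    have "\<A> \<noteq> {}" "\<B> \<noteq> {}" using step.prems M by auto
    then show ?case
      using slide_fixing_trace_back[OF good_entries_ge_3[OF c v(2)] good_entries_ge_3[OF d v(2)] step(2,3,4,1) T(1) t T(2,3)] by blast
  qed
  then obtain T where T: "card T = t" "\<A> \<subseteq> fixing c r T" "\<B> \<subseteq> fixing d s T" by blast
  show "\<exists>T. card T = t \<and> \<A> = fixing c r T \<and> \<B> = fixing d s T"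
    by (rule exI[of _ T]) (rule conjI[OF T(1) fill[OF T eqM]])
qed

section \<open>Several families of labelled sets\<close>

text \<open>
  A labelled set that has the label 1 at \<open>1, \<dots>, t\<close> is determined by its remaining positions \<open>I\<close> and a
  choice of labels on \<open>I\<close>.
\<close>

lemma card_labelled_sets_fixing:
  assumes c: "IP_seq c" and t: "t \<le> r" "r \<le> length c"
  shows "card (labelled_sets_fixing c r t) = (\<Sum>I\<in>nsets {t + 1..length c} (r - t). \<Prod>j\<in>I. entry c j)"
proof -
  let ?N = "nsets {t + 1..length c} (r - t)"
  define D where "D = (SIGMA I:?N. PiE I (\<lambda>j. {1..entry c j}))"
  define h where "h = (\<lambda>(I, f). (\<lambda>x. (x, if x \<le> t then 1 else f x)) ` ({1..t} \<union> I) :: (nat \<times> nat) set)"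
  have finN: "finite ?N" by (simp add: finite_imp_finite_nsets)
  have NI: "I \<subseteq> {t + 1..length c}" "finite I" "card I = r - t" if "I \<in> ?N" for I
    using that by (auto simp: nsets_def)
  have entry_pos: "1 \<le> entry c x" if "x \<in> {1..length c}" for x
    using c that by (auto simp: IP_seq_def entry_def Suc_le_eq)
  have "bij_betw h D (labelled_sets_fixing c r t)"
  proof (rule bij_betw_imageI)
    show "inj_on h D"
    proof (rule inj_onI)
      fix P Q assume PQ: "P \<in> D" "Q \<in> D" "h P = h Q"
      obtain I f J g where IJ: "P = (I, f)" "Q = (J, g)" by (cases P; cases Q)
      have I: "I \<in> ?N" "f \<in> PiE I (\<lambda>j. {1..entry c j})" and J: "J \<in> ?N" "g \<in> PiE J (\<lambda>j. {1..entry c j})"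
        using PQ IJ by (auto simp: D_def)
      have mem: "(x, y) \<in> h (I, f) \<longleftrightarrow> x \<in> I \<and> y = f x" if "t < x" "I \<in> ?N" for x y I f
        using that NI(1)[OF that(2)] by (auto simp: h_def)
      have gt: "t < x" if "x \<in> I \<union> J" for x using that NI(1)[OF I(1)] NI(1)[OF J(1)] by force
      have eq: "x \<in> I \<and> y = f x \<longleftrightarrow> x \<in> J \<and> y = g x" if "t < x" for x y
        using mem[OF that I(1), of y f] mem[OF that J(1), of y g] PQ(3) IJ by simp
      have "I = J" using eq gt by blast
      moreover have "f = g"
      proof (rule PiE_ext[OF I(2)])
        show "g \<in> PiE I (\<lambda>j. {1..entry c j})" using J(2) \<open>I = J\<close> by simp
        show "f x = g x" if "x \<in> I" for x using eq[of x "f x"] gt[of x] that by simp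
      qed
      ultimately show "P = Q" using IJ by simp
    qed
    show "h ` D = labelled_sets_fixing c r t"
    proof (intro equalityI subsetI)
      fix A assume "A \<in> h ` D"
      then obtain I f where I: "I \<in> ?N" "f \<in> PiE I (\<lambda>j. {1..entry c j})" and A: "A = h (I, f)"
        by (auto simp: D_def)
      define y where "y = (\<lambda>x. if x \<le> t then 1 else f x)"
      have "{1..t} \<inter> I = {}" using NI(1)[OF I(1)] by force
      then have "card ({1..t} \<union> I) = r" using NI(2,3)[OF I(1)] t by (simp add: card_Un_disjoint)
      moreover have sub: "{1..t} \<union> I \<subseteq> {1..length c}" using NI(1)[OF I(1)] t by force
      ultimately have "{1..t} \<union> I \<in> nsets {1..length c} r"
        using NI(2)[OF I(1)] by (simp add: nsets_def)
      moreover have "y x \<in> {1..entry c x}" if x: "x \<in> {1..t} \<union> I" for x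
      proof (cases "x \<le> t")
        case True
        moreover have "x \<in> {1..length c}" using sub x by blast
        ultimately show ?thesis using entry_pos[of x] by (simp add: y_def)
      next
        case False
        then have "x \<in> I" using x by simp
        then show ?thesis using I(2) False by (auto simp: y_def)
      qed
      moreover have "A = (\<lambda>x. (x, y x)) ` ({1..t} \<union> I)" by (simp add: A h_def y_def)
      ultimately have "A \<in> labelled_sets c r" unfolding labelled_sets_def by blast
      moreover have "(x, 1) \<in> A" if "x \<in> {1..t}" for x
        using that by (auto simp: A h_def intro!: image_eqI[of _ _ x])
      ultimately show "A \<in> labelled_sets_fixing c r t" by (simp add: labelled_sets_fixing_def)
    next
      fix A assume A: "A \<in> labelled_sets_fixing c r t"
      then obtain X y where X: "X \<in> nsets {1..length c} r" "\<forall>x\<in>X. y x \<in> {1..entry c x}"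
        and AX: "A = (\<lambda>x. (x, y x)) ` X" unfolding labelled_sets_fixing_def labelled_sets_def by blast
      have tX: "x \<in> X \<and> y x = 1" if "x \<in> {1..t}" for x
      proof -
        have "(x, 1) \<in> A" using A that unfolding labelled_sets_fixing_def by blast
        then show ?thesis unfolding AX by auto
      qed
      have X': "X \<subseteq> {1..length c}" "finite X" "card X = r" using X(1) by (auto simp: nsets_def)
      define I where "I = X - {1..t}"
      have sub: "{1..t} \<subseteq> X" using tX by blast
      have "x \<in> {t + 1..length c}" if "x \<in> I" for x
        using that X'(1) by (auto simp: I_def subset_iff not_le)
      moreover have "card I = r - t" using sub X' by (simp add: I_def card_Diff_subset)
      ultimately have "I \<in> ?N" using X'(2) by (auto simp: nsets_def I_def)
      moreover have "restrict y I \<in> PiE I (\<lambda>j. {1..entry c j})" using X(2) by (auto simp: I_def)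
      ultimately have "(I, restrict y I) \<in> D" by (simp add: D_def)
      moreover have "h (I, restrict y I) = A"
      proof -
        have XI: "{1..t} \<union> I = X" using sub by (auto simp: I_def)
        have "(if x \<le> t then 1 else restrict y I x) = y x" if "x \<in> X" for x
          using that tX[of x] X'(1) by (auto simp: I_def)
        then show ?thesis unfolding h_def AX using XI by simp
      qed
      ultimately show "A \<in> h ` D" by blast
    qed
  qed
  then have "card (labelled_sets_fixing c r t) = card D" by (simp add: bij_betw_same_card)
  also have "\<dots> = (\<Sum>I\<in>?N. card (PiE I (\<lambda>j. {1..entry c j})))"
    unfolding D_def using finN NI(2) by (intro card_SigmaI) (auto intro!: finite_PiE)
  also have "\<dots> = (\<Sum>I\<in>?N. \<Prod>j\<in>I. entry c j)"
    using NI(2) by (intro sum.cong) (simp_all add: card_PiE)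
  finally show ?thesis .
qed

text \<open>
  The pair theorem applied to one family taken twice.
\<close>

lemma card_fixing_le:
  assumes c: "good_entries v c" and v: "real t \<le> v" "real t + 4 < 2 * v"
    and r: "t \<le> r" "r \<le> length c" and T: "card T = t"
  shows "card (fixing c r T) \<le> card (labelled_sets_fixing c r t)"
proof -
  have "fixing c r T \<subseteq> labelled_sets c r" by (auto simp: members_containing_def)
  from pair_bound(1)[OF c c v r r this this cross_fixing[OF T]] show ?thesis
    by (metis mult_le_mono mult_strict_mono' not_le le0)
qed

text \<open>
  An element of \<open>T'\<close> outside \<open>T\<close> could be relabelled within a member containing \<open>T\<close>.
\<close>

lemma fixing_inject:
  assumes c: "\<And>x. x \<in> {1..length c} \<Longrightarrow> 2 \<le> entry c x"
    and ne: "fixing c r T \<noteq> {}" and eq: "fixing c r T = fixing c r T'"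
  shows "T = T'"
proof -
  have "T' \<subseteq> T" if ne: "fixing c r T \<noteq> {}" and eq: "fixing c r T = fixing c r T'" for T T'
  proof
    fix z assume z: "z \<in> T'"
    obtain A where A: "A \<in> labelled_sets c r" "T \<subseteq> A" using ne by (auto simp: members_containing_def)
    then have "A \<in> fixing c r T'" using eq by (auto simp: members_containing_def)
    then have zA: "z \<in> A" using z by (auto simp: members_containing_def)
    obtain x y where xy: "z = (x, y)" by (cases z)
    define y' :: nat where "y' = (if y = 1 then 2 else 1)"
    define B where "B = insert (x, y') (A - {(x, y)})"
    have "x \<in> {1..length c}" using labelled_setsD(1)[OF A(1), of x y] zA xy by simp
    then have "y' \<le> entry c x" "1 \<le> y'" using c[of x] by (auto simp: y'_def)
    then have B: "B \<in> labelled_sets c r"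
      unfolding B_def using zA xy by (intro labelled_sets_relabel[OF A(1)]) auto
    have "z \<notin> B" using xy by (auto simp: B_def y'_def)
    show "z \<in> T"
    proof (rule ccontr)
      assume "z \<notin> T"
      then have "B \<in> fixing c r T" using B A(2) xy by (auto simp: B_def members_containing_def)
      then have "B \<in> fixing c r T'" using eq by simp
      then show False using z \<open>z \<notin> B\<close> by (auto simp: members_containing_def)
    qed
  qed
  from this[OF ne eq] this[OF ne[unfolded eq] eq[symmetric]] show ?thesis by (rule equalityI[rotated])
qed

lemma mem_labelled_sets_of_fixing:
  assumes "fixing c r T \<noteq> {}"
  shows "T \<in> labelled_sets c (card T)"
proof -
  obtain A where "A \<in> labelled_sets c r" "T \<subseteq> A" using assms by (auto simp: members_containing_def)
  then show ?thesis unfolding mem_labelled_sets_iff by (auto intro: inj_on_subset)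
qed

text \<open>
  Let \<open>a m\<close> be the largest factor. Any other factor is at most 1, because its square is at most its
  product with \<open>a m\<close>. So the whole product is at most \<open>a m * a j\<close> for every \<open>j \<noteq> m\<close>, which also
  gives the equality case.
\<close>

lemma prod_le_1_of_pairwise:
  fixes a :: "'b \<Rightarrow> real"
  assumes K: "finite K" "2 \<le> card K" and nn: "\<And>i. i \<in> K \<Longrightarrow> 0 \<le> a i"
    and pair: "\<And>i j. i \<in> K \<Longrightarrow> j \<in> K \<Longrightarrow> i \<noteq> j \<Longrightarrow> a i * a j \<le> 1"
  shows "prod a K \<le> 1"
    and "prod a K = 1 \<Longrightarrow> \<exists>m\<in>K. \<forall>j\<in>K - {m}. a m * a j = 1"
proof -
  have "K \<noteq> {}" using K by auto
  then have "Max (a ` K) \<in> a ` K" using K(1) by (intro Max_in) auto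
  then obtain m where m: "m \<in> K" "a m = Max (a ` K)" by auto
  have max: "a j \<le> a m" if "j \<in> K" for j using m(2) that K(1) by simp
  have le1: "a j \<le> 1" if "j \<in> K" "j \<noteq> m" for j
  proof (rule ccontr)
    assume "\<not> a j \<le> 1"
    then have "1 * 1 < a j * a j" by (intro mult_strict_mono) auto
    also have "\<dots> \<le> a m * a j" using max that nn by (intro mult_right_mono) auto
    finally show False using pair[OF m(1) that(1)] that(2) by simp
  qed
  have le: "prod a K \<le> a m * a j" if j: "j \<in> K" "j \<noteq> m" for j
  proof -
    have "prod a K = a m * (a j * prod a (K - {m} - {j}))"
      using K(1) m(1) j by (simp add: prod.remove)
    also have "prod a (K - {m} - {j}) \<le> 1" using le1 nn by (intro prod_le_1) auto
    then have "a m * (a j * prod a (K - {m} - {j})) \<le> a m * (a j * 1)"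
      using nn m(1) j by (intro mult_left_mono) auto
    finally show ?thesis by simp
  qed
  have "\<exists>j\<in>K. j \<noteq> m"
  proof (rule ccontr)
    assume "\<not> ?thesis"
    then have "K \<subseteq> {m}" by blast
    then have "card K \<le> 1" using card_mono[of "{m}" K] by simp
    then show False using K(2) by simp
  qed
  then obtain j0 where j0: "j0 \<in> K" "j0 \<noteq> m" by blast
  show "prod a K \<le> 1" using le[OF j0] pair[OF m(1) j0(1)] j0(2) by auto
  show "\<exists>m\<in>K. \<forall>j\<in>K - {m}. a m * a j = 1" if "prod a K = 1"
  proof (intro bexI[OF _ m(1)] ballI)
    fix j assume "j \<in> K - {m}"
    then show "a m * a j = 1" using le[of j] pair[OF m(1), of j] that by force
  qed
qed

theorem theorem2p3:
  fixes k t :: nat and u :: real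
    and c :: "nat \<Rightarrow> nat list" and n r :: "nat \<Rightarrow> nat"
    and \<A> :: "nat \<Rightarrow> (nat \<times> nat) set set"
  assumes "k \<ge> 2"
    and "\<And>i. i \<in> {1..k} \<Longrightarrow> IP_seq (c i) \<and> length (c i) = n i"
    and "\<And>i. i \<in> {1..k} \<Longrightarrow> r i \<in> {1..n i}"
    and "t \<in> {1..Min (r ` {1..k})}"
    and "u \<ge> 0"
    and "u > (6 - real t) / 3"
    and "\<And>i. i \<in> {1..k} \<Longrightarrow> real (entry (c i) 1) \<ge> real t + u + 1"
    and "\<And>i. i \<in> {1..k} \<Longrightarrow> \<A> i \<subseteq> labelled_sets (c i) (r i)"
    and "cross_intersecting t k \<A>"
  shows "(\<Prod>i\<in>{1..k}. card (\<A> i)) \<le>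
           (\<Prod>i\<in>{1..k}. \<Sum>I\<in>nsets {t + 1..n i} (r i - t). \<Prod>j\<in>I. entry (c i) j) \<and>
         (u > 0 \<longrightarrow>
           ((\<Prod>i\<in>{1..k}. card (\<A> i)) =
              (\<Prod>i\<in>{1..k}. \<Sum>I\<in>nsets {t + 1..n i} (r i - t). \<Prod>j\<in>I. entry (c i) j)
            \<longleftrightarrow>
            (\<exists>T \<in> (\<Inter>i\<in>{1..k}. labelled_sets (c i) t).
               (\<forall>i\<in>{1..k}. card (members_containing (labelled_sets (c i) (r i)) T)
                            = card (labelled_sets_fixing (c i) (r i) t)) \<and>
               (\<forall>i\<in>{1..k}. \<A> i = members_containing (labelled_sets (c i) (r i)) T))))"
proof -
  define v where "v = real t + u"
  define K where "K = {1..k}"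
  define M where "M i = card (labelled_sets_fixing (c i) (r i) t)" for i
  define a where "a i = real (card (\<A> i)) / real (M i)" for i
  have t1: "1 \<le> t" using assms(4) by simp
  have v: "real t \<le> v" "real t + 4 < 2 * v" using assms(5,6) t1 by (auto simp: v_def field_simps)
  have len: "length (c i) = n i" "IP_seq (c i)" if "i \<in> K" for i using assms(2) that by (auto simp: K_def)
  have r: "t \<le> r i" "r i \<le> length (c i)" if "i \<in> K" for i
  proof -
    have "Min (r ` {1..k}) \<le> r i" using that by (intro Min_le) (auto simp: K_def)
    then show "t \<le> r i" using assms(4) by simp
    show "r i \<le> length (c i)" using assms(3)[of i] that len(1)[OF that] by (simp add: K_def)
  qed
  have good: "good_entries v (c i)" if "i \<in> K" for i
    unfolding good_entries_def
  proof (intro conjI ballI)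
    fix x assume x: "x \<in> {1..length (c i)}"
    have "entry (c i) 1 \<le> entry (c i) x" using x by (intro entry_mono len(2)[OF that]) auto
    then show "v + 1 \<le> real (entry (c i) x)" using assms(7)[of i] that by (simp add: v_def K_def)
  qed (rule len(2)[OF that])
  have sub: "\<A> i \<subseteq> labelled_sets (c i) (r i)" if "i \<in> K" for i using assms(8) that by (simp add: K_def)
  have cr: "cross t (\<A> i) (\<A> j)" if "i \<in> K" "j \<in> K" "i \<noteq> j" for i j
    using assms(9) that by (simp add: cross_intersecting_def cross_def K_def)
  have M_eq: "M i = (\<Sum>I\<in>nsets {t + 1..n i} (r i - t). \<Prod>j\<in>I. entry (c i) j)" if "i \<in> K" for i
    using card_labelled_sets_fixing[OF len(2)[OF that] r[OF that]] len(1)[OF that] by (simp add: M_def)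
  have Mpos: "0 < M i" if "i \<in> K" for i
    unfolding M_def by (rule card_labelled_sets_fixing_pos[OF good[OF that] v(2) r[OF that]])
  have prodM: "(\<Prod>i\<in>K. \<Sum>I\<in>nsets {t + 1..n i} (r i - t). \<Prod>j\<in>I. entry (c i) j) = prod M K"
    by (intro prod.cong) (simp_all only: M_eq)
  have K: "finite K" "2 \<le> card K" using assms(1) by (auto simp: K_def)
  have pair_le: "card (\<A> i) * card (\<A> j) \<le> M i * M j" if "i \<in> K" "j \<in> K" "i \<noteq> j" for i j
    unfolding M_def
    by (rule pair_bound(1)[OF good[OF that(1)] good[OF that(2)] v r[OF that(1)] r[OF that(2)]
          sub[OF that(1)] sub[OF that(2)] cr[OF that]])
  have a_pair: "a i * a j \<le> 1" if "i \<in> K" "j \<in> K" "i \<noteq> j" for i j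
  proof -
    have "real (card (\<A> i)) * real (card (\<A> j)) \<le> real (M i) * real (M j)"
      using pair_le[OF that] unfolding of_nat_mult[symmetric] of_nat_le_iff .
    then show ?thesis using Mpos[OF that(1)] Mpos[OF that(2)] by (simp add: a_def field_simps)
  qed
  have a_prod: "real (\<Prod>i\<in>K. card (\<A> i)) = prod a K * real (prod M K)"
  proof -
    have "prod a K * real (prod M K) = (\<Prod>i\<in>K. a i * real (M i))" by (simp add: prod.distrib)
    also have "\<dots> = (\<Prod>i\<in>K. real (card (\<A> i)))"
      using Mpos by (intro prod.cong) (auto simp: a_def)
    finally show ?thesis by simp
  qed
  have PM: "0 < prod M K" using Mpos by (intro prod_pos) auto
  note ap = prod_le_1_of_pairwise[OF K, of a, OF _ a_pair]
  have nn: "0 \<le> a i" for i by (simp add: a_def)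
  have bound: "(\<Prod>i\<in>K. card (\<A> i)) \<le> prod M K"
  proof -
    have "prod a K * real (prod M K) \<le> 1 * real (prod M K)"
      by (intro mult_right_mono ap(1) nn of_nat_0_le_iff)
    then have "real (\<Prod>i\<in>K. card (\<A> i)) \<le> real (prod M K)" unfolding a_prod by simp
    then show ?thesis by (rule of_nat_le_iff[THEN iffD1])
  qed
  have attained: "\<exists>T \<in> (\<Inter>i\<in>K. labelled_sets (c i) t).
      (\<forall>i\<in>K. card (fixing (c i) (r i) T) = M i) \<and> (\<forall>i\<in>K. \<A> i = fixing (c i) (r i) T)"
    if u: "0 < u" and eq: "(\<Prod>i\<in>K. card (\<A> i)) = prod M K"
  proof -
    have tv: "real t < v" using u by (simp add: v_def)
    define m where "m = real (prod M K)"
    have "prod a K * m = m" "m \<noteq> 0" using a_prod eq PM by (simp_all only: m_def of_nat_eq_0_iff)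
    then have "prod a K = 1" by simp
    then obtain m where m: "m \<in> K" "\<forall>j\<in>K - {m}. a m * a j = 1" using ap(2)[OF nn] by blast
    have pair_eq: "card (\<A> m) * card (\<A> j) = M m * M j" if "j \<in> K - {m}" for j
    proof -
      have "real (card (\<A> m)) * real (card (\<A> j)) = real (M m) * real (M j)"
        using m that Mpos[of m] Mpos[of j] by (force simp: a_def field_simps)
      then show ?thesis unfolding of_nat_mult[symmetric] of_nat_eq_iff .
    qed
    have ex: "\<exists>T. card T = t \<and> \<A> m = fixing (c m) (r m) T \<and> \<A> j = fixing (c j) (r j) T"
      if "j \<in> K - {m}" for j
    proof -
      have j: "j \<in> K" "m \<noteq> j" using that by auto
      show ?thesis
        by (rule pair_bound(2)[OF good[OF m(1)] good[OF j(1)] v r[OF m(1)] r[OF j(1)]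
              sub[OF m(1)] sub[OF j(1)] cr[OF m(1) j] t1 tv pair_eq[OF that, unfolded M_def]])
    qed
    have "\<not> K \<subseteq> {m}"
    proof
      assume "K \<subseteq> {m}"
      then have "card K \<le> 1" using card_mono[of "{m}" K] by simp
      then show False using K(2) by simp
    qed
    then obtain j0 where j0: "j0 \<in> K - {m}" by blast
    from ex[OF j0] obtain T where T: "card T = t" "\<A> m = fixing (c m) (r m) T" by blast
    have ne: "\<A> i \<noteq> {}" if "i \<in> K" for i
    proof
      assume "\<A> i = {}"
      then have "(\<Prod>i\<in>K. card (\<A> i)) = 0" using that K(1) by (intro prod_zero bexI[of _ i]) simp_all
      then show False using eq PM by simp
    qed
    have ent: "2 \<le> entry (c m) x" if "x \<in> {1..length (c m)}" for x
    proof -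
      have "v + 1 \<le> real (entry (c m) x)" using good[OF m(1)] that by (simp add: good_entries_def)
      then show ?thesis using v by simp
    qed
    have all: "\<A> i = fixing (c i) (r i) T" if iK: "i \<in> K" for i
    proof (cases "i = m")
      case False
      then obtain T' where T': "\<A> m = fixing (c m) (r m) T'" "\<A> i = fixing (c i) (r i) T'"
        using ex[of i] iK by blast
      have "T = T'"
        by (rule fixing_inject[OF ent, where r = "r m"]) (use ne[OF m(1)] T(2) T'(1) in simp_all)
      then show ?thesis using T'(2) by simp
    qed (use T in simp)
    have le: "card (\<A> i) \<le> M i" if "i \<in> K" for i
      unfolding all[OF that] M_def by (rule card_fixing_le[OF good[OF that] v r[OF that] T(1)])
    have cpos: "0 < card (\<A> i)" if "i \<in> K" for i
      using ne[OF that] sub[OF that] finite_labelled_sets finite_subset by (metis card_gt_0_iff)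
    have "card (\<A> i) = M i" if i: "i \<in> K" for i
    proof -
      have *: "card (\<A> m) = M m \<and> card (\<A> j) = M j" if j: "j \<in> K - {m}" for j
        using pair_eq[OF j] cpos le m(1) j by (intro nat_mult_le_imp_eq) auto
      show ?thesis using *[OF j0] *[of i] i by (cases "i = m") auto
    qed
    then have "\<forall>i\<in>K. card (fixing (c i) (r i) T) = M i" using all by simp
    moreover have "T \<in> labelled_sets (c i) t" if "i \<in> K" for i
      using mem_labelled_sets_of_fixing[of "c i" "r i" T] ne[OF that] all[OF that] T(1) by simp
    ultimately show ?thesis using all by (intro bexI[of _ T]) auto
  qed
  have conversely: "(\<Prod>i\<in>K. card (\<A> i)) = prod M K"
    if "\<forall>i\<in>K. card (fixing (c i) (r i) T) = M i" "\<forall>i\<in>K. \<A> i = fixing (c i) (r i) T" for T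
    using that by (intro prod.cong) auto
  show ?thesis
    unfolding K_def[symmetric] prodM M_def[symmetric]
  proof (intro conjI impI iffI)
    assume "\<exists>T\<in>(\<Inter>i\<in>K. labelled_sets (c i) t).
      (\<forall>i\<in>K. card (fixing (c i) (r i) T) = M i) \<and> (\<forall>i\<in>K. \<A> i = fixing (c i) (r i) T)"
    then show "(\<Prod>i\<in>K. card (\<A> i)) = prod M K" by (elim bexE conjE) (rule conversely)
  next
    show "(\<Prod>i\<in>K. card (\<A> i)) \<le> prod M K" by (rule bound)
  next
    assume "0 < u" "(\<Prod>i\<in>K. card (\<A> i)) = prod M K"
    then show "\<exists>T\<in>(\<Inter>i\<in>K. labelled_sets (c i) t).
      (\<forall>i\<in>K. card (fixing (c i) (r i) T) = M i) \<and> (\<forall>i\<in>K. \<A> i = fixing (c i) (r i) T)"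
      by (rule attained)
  qed
qed

end
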